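(* Fix $K\in\mathbb{N}$, $\mu>0$ and a valuation distribution $G$. Consider a family of $K$-server pricing systems indexed by the arrival rate $\lambda$, where the system with index $\lambda$ has i.i.d. interarrival times with mean $1/\lambda$ and Laplace–Stieltjes transform $\phi=\phi_\lambda$. Suppose that $\lim_{\lambda\to\infty}\lambda(1-\phi(\mu))=\tilde\mu$ exists. Let $p\ge0$ be a fixed price with $\overline{G}(p)>0$. Then the mean revenue rate $R(K,p\mathbf 1)$ under the uniform price vector $p\mathbf 1$ remains bounded as the arrival rate $\lambda$ grows, and in particular $$\lim_{\lambda\to\infty}R(K,p\mathbf 1)=\tilde\mu\,p\,K.$$
   Context: $K$-server pricing system with arrival rate $\lambda$: jobs arrive at times $A_n=\sum_{i=1}^n U_i$, where the $U_n\ge0$ are i.i.d. with mean $1/\lambda\in(0,\infty)$ and $\phi(s)=\mathbb{E}[e^{-sU_1}]$. Job $n$ has service time $S_n$ (i.i.d. exponential with mean $1/\mu$) and valuation $V_n$ (i.i.d., positive, with continuous distribution function $G$ and finite mean); $(U_n),(S_n),(V_n)$ are mutually independent. $\overline{G}(u)=P(V_1\ge u)$. Under the uniform price vector $p\mathbf 1$: if job $n$ finds fewer than $K$ servers busy on arrival and $V_n\ge p$, it is admitted to an idle server and pays $p$; otherwise it leaves forever, paying nothing. Admitted jobs leave upon service completion. With $R(t)$ the total revenue collected in $[0,t]$, the mean revenue rate is $R(K,p\mathbf 1)=\lim_{t\to\infty}\mathbb{E}R(t)/t$. *)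

theory Defs
  imports "HOL-Probability.Probability"
begin

text \<open>
  Jobs are numbered from 0, so that job \<open>n\<close> is the \<open>(n+1)\<close>-st arrival. The sequences
  \<open>u\<close>, \<open>s\<close>, \<open>v\<close> below are one sample path of the interarrival times, service times and
  valuations.
\<close>

definition arrival_time :: "(nat \<Rightarrow> real) \<Rightarrow> nat \<Rightarrow> real" where
  "arrival_time u n = (\<Sum>i\<le>n. u i)"

text \<open>
  The system is empty at time 0. Since every admitted job occupies its server from its arrival
  until the end of its service, the number of busy servers found by job \<open>n\<close> is the number of
  earlier admitted jobs whose departure lies strictly after the arrival of job \<open>n\<close>.
\<close>

context
  notes conj_cong [fundef_cong]
begin

fun admitted ::
  "nat \<Rightarrow> real \<Rightarrow> (nat \<Rightarrow> real) \<Rightarrow> (nat \<Rightarrow> real) \<Rightarrow> (nat \<Rightarrow> real) \<Rightarrow> nat \<Rightarrow> bool" where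
  "admitted K p u s v n \<longleftrightarrow>
     card {m. m < n \<and> admitted K p u s v m \<and> arrival_time u n < arrival_time u m + s m} < K
     \<and> p \<le> v n"

end

declare admitted.simps [simp del]

text \<open>
  Almost surely only finitely many summands are nonzero, because the interarrival times are
  i.i.d. and nonnegative with positive mean.
\<close>

definition revenue ::
  "nat \<Rightarrow> real \<Rightarrow> (nat \<Rightarrow> real) \<Rightarrow> (nat \<Rightarrow> real) \<Rightarrow> (nat \<Rightarrow> real) \<Rightarrow> real \<Rightarrow> real" where
  "revenue K p u s v t = (\<Sum>n. if arrival_time u n \<le> t \<and> admitted K p u s v n then p else 0)"

definition expected_revenue ::
  "'a measure \<Rightarrow> (nat \<Rightarrow> 'a \<Rightarrow> real) \<Rightarrow> (nat \<Rightarrow> 'a \<Rightarrow> real) \<Rightarrow> (nat \<Rightarrow> 'a \<Rightarrow> real) \<Rightarrow>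
   nat \<Rightarrow> real \<Rightarrow> real \<Rightarrow> real" where
  "expected_revenue M U S V K p t =
     (\<integral>\<omega>. revenue K p (\<lambda>n. U n \<omega>) (\<lambda>n. S n \<omega>) (\<lambda>n. V n \<omega>) t \<partial>M)"

definition mean_revenue_rate ::
  "'a measure \<Rightarrow> (nat \<Rightarrow> 'a \<Rightarrow> real) \<Rightarrow> (nat \<Rightarrow> 'a \<Rightarrow> real) \<Rightarrow> (nat \<Rightarrow> 'a \<Rightarrow> real) \<Rightarrow>
   nat \<Rightarrow> real \<Rightarrow> real" where
  "mean_revenue_rate M U S V K p = Lim at_top (\<lambda>t. expected_revenue M U S V K p t / t)"

definition laplace_stieltjes :: "'a measure \<Rightarrow> ('a \<Rightarrow> real) \<Rightarrow> real \<Rightarrow> real" where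
  "laplace_stieltjes M X s = (\<integral>\<omega>. exp (- s * X \<omega>) \<partial>M)"

text \<open>
  The valuation distribution is given as a measure \<open>G\<close> on the reals, whose distribution function
  is \<open>cdf G\<close> and whose survival function is \<open>u \<mapsto> measure G {u..}\<close>.
\<close>

locale valuation_distribution = real_distribution G for G :: "real measure" +
  assumes continuous_cdf: "continuous_on UNIV (cdf G)"
    and positive: "AE x in G. 0 < x"
    and finite_mean: "integrable G (\<lambda>x. x)"

text \<open>
  The independence assumption on the family indexed by the disjoint sum expresses both the
  independence within each of the three sequences and the mutual independence of the sequences.
\<close>

locale pricing_system = prob_space M + valuation_dist: valuation_distribution G
  for M :: "'a measure" and G :: "real measure" +
  fixes U S V :: "nat \<Rightarrow> 'a \<Rightarrow> real"
    and arrival_rate \<mu> :: real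
  assumes arrival_rate_pos: "0 < arrival_rate"
    and service_rate_pos: "0 < \<mu>"
    and indep: "indep_vars (\<lambda>_. borel) (case_sum U (case_sum S V)) (UNIV :: (nat + nat + nat) set)"
    and U_ident: "distr M borel (U n) = distr M borel (U 0)"
    and U_nonneg: "AE \<omega> in M. 0 \<le> U n \<omega>"
    and U_integrable: "integrable M (U n)"
    and U_mean: "expectation (U n) = 1 / arrival_rate"
    and S_exponential: "distributed M lborel (S n) (exponential_density \<mu>)"
    and V_law: "distr M borel (V n) = G"

end

theory Submission
  imports Defs
begin

text \<open>
  Let \<open>X\<^sub>k\<close> be the number of busy servers found by job \<open>k\<close>, \<open>q = P(V \<ge> p)\<close> and
  \<open>\<phi>\<^sub>j = \<phi>(j\<mu>)\<close>. Counting \<open>j\<close>-subsets of jobs that are still in service, memorylessness of the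
  service times gives
  \<open>E[1(A\<^sub>k \<le> t) (X\<^bsub>k+1\<^esub> choose j)] =
    \<phi>\<^sub>j E[1(A\<^sub>k \<le> t) ((X\<^sub>k choose j) + q 1(X\<^sub>k < K) (X\<^sub>k choose (j - 1)))]\<close>.
  Hence a suitable combination \<open>h\<close> of binomial coefficients solves the Poisson equation
  \<open>E[h(X\<^bsub>k+1\<^esub>) - h(X\<^sub>k) | past] = 1 - D 1(X\<^sub>k = K)\<close> with
  \<open>D = (\<Sum>i\<le>K. (K choose i) (\<Prod>j=1..i. (1 - \<phi>\<^sub>j) / (q \<phi>\<^sub>j)))\<close>. Restricted to the jobs arriving up to
  time \<open>t\<close> the left-hand side telescopes to a bounded quantity, so a fraction \<open>1 / D\<close> of these
  jobs is blocked in the long run. With the elementary renewal theorem the revenue rate is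
  \<open>p q \<lambda> (1 - 1 / D)\<close>. As \<open>\<lambda> \<rightarrow> \<infinity>\<close>, all \<open>\<phi>\<^sub>j\<close> tend to 1, and \<open>\<lambda> (D - 1)\<close> is dominated by its first
  term, \<open>K \<lambda> (1 - \<phi>\<^sub>1) / (q \<phi>\<^sub>1)\<close>.
\<close>

subsection \<open>Sample paths\<close>

lemma arrival_time_mono:
  assumes "\<And>i. 0 \<le> u i" "m \<le> n"
  shows "arrival_time u m \<le> arrival_time u n"
  unfolding arrival_time_def by (rule sum_mono2) (use assms in auto)

lemma arrival_time_Suc: "arrival_time u (Suc n) = arrival_time u n + u (Suc n)"
  by (simp add: arrival_time_def)

definition present ::
  "nat \<Rightarrow> real \<Rightarrow> (nat \<Rightarrow> real) \<Rightarrow> (nat \<Rightarrow> real) \<Rightarrow> (nat \<Rightarrow> real) \<Rightarrow> nat \<Rightarrow> nat set" where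
  "present K p u s v n =
     {m. m < n \<and> admitted K p u s v m \<and> arrival_time u n < arrival_time u m + s m}"

text \<open>State just after the \<open>n\<close>-th arrival: job \<open>n\<close> now counts.
  Between arrivals only departures happen, so the step from \<open>present_after\<close> at
  \<open>n\<close> to \<open>present\<close> at \<open>Suc n\<close> is pure service.\<close>

definition present_after ::
  "nat \<Rightarrow> real \<Rightarrow> (nat \<Rightarrow> real) \<Rightarrow> (nat \<Rightarrow> real) \<Rightarrow> (nat \<Rightarrow> real) \<Rightarrow> nat \<Rightarrow> nat set" where
  "present_after K p u s v n =
     {m. m \<le> n \<and> admitted K p u s v m \<and> arrival_time u n < arrival_time u m + s m}"

lemma admitted_iff: "admitted K p u s v n \<longleftrightarrow> card (present K p u s v n) < K \<and> p \<le> v n"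
  unfolding present_def by (subst admitted.simps) simp

lemma finite_present [simp]: "finite (present K p u s v n)"
  unfolding present_def by simp

lemma finite_present_after [simp]: "finite (present_after K p u s v n)"
  unfolding present_after_def by simp

lemma card_present_after:
  assumes "0 < s n"
  shows "card (present_after K p u s v n) =
           card (present K p u s v n) + of_bool (admitted K p u s v n)"
proof -
  have "present_after K p u s v n =
          present K p u s v n \<union> (if admitted K p u s v n then {n} else {})"
    using assms by (auto simp: present_after_def present_def le_less)
  moreover have "n \<notin> present K p u s v n"
    by (simp add: present_def)
  ultimately show ?thesis
    by simp
qed

lemma present_Suc_subset:
  assumes "\<And>i. 0 \<le> u i"
  shows "present K p u s v (Suc n) \<subseteq> present_after K p u s v n"
  using assms[of "Suc n"] by (auto simp: present_after_def present_def arrival_time_Suc)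

text \<open>The admission rule adds a job only when fewer than \<open>K\<close> are present, and
  waiting for the next arrival can only shrink the set.\<close>

lemma card_present_le:
  assumes "\<And>i. 0 \<le> u i" "\<And>i. 0 < s i"
  shows "card (present K p u s v n) \<le> K"
proof (induction n)
  case 0
  then show ?case by (simp add: present_def)
next
  case (Suc n)
  have "card (present K p u s v (Suc n)) \<le> card (present_after K p u s v n)"
    by (rule card_mono) (use present_Suc_subset assms in auto)
  also have "\<dots> \<le> K"
    using Suc assms by (auto simp: card_present_after admitted_iff)
  finally show ?case .
qed

text \<open>Decisions see a path only through comparisons of later arrivals with earlier departures
  and through the price threshold, so strong induction transfers them between paths that agree on
  these.\<close>

lemma admitted_cong:
  assumes "\<And>m i. m < i \<Longrightarrow> i \<le> n \<Longrightarrow>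
             arrival_time u i < arrival_time u m + s m \<longleftrightarrow>
             arrival_time u' i < arrival_time u' m + s' m"
    and "\<And>m. m \<le> n \<Longrightarrow> p \<le> v m \<longleftrightarrow> p \<le> v' m"
    and "m \<le> n"
  shows "admitted K p u s v m \<longleftrightarrow> admitted K p u' s' v' m"
  using \<open>m \<le> n\<close>
proof (induction m rule: less_induct)
  case (less m)
  have "present K p u s v m = present K p u' s' v' m"
    unfolding present_def using less assms(1) by auto
  then show ?case
    using assms(2) less.prems by (simp add: admitted_iff)
qed

text \<open>Only valuations of jobs before \<open>n\<close> enter; this later makes the valuation of
  job \<open>n\<close> independent of the state that it finds.\<close>

lemma present_cong:
  assumes "\<And>m i. m < i \<Longrightarrow> i \<le> n \<Longrightarrow>
             arrival_time u i < arrival_time u m + s m \<longleftrightarrow>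
             arrival_time u' i < arrival_time u' m + s' m"
    and "\<And>m. m < n \<Longrightarrow> p \<le> v m \<longleftrightarrow> p \<le> v' m"
  shows "present K p u s v n = present K p u' s' v' n"
proof -
  have "admitted K p u s v m \<longleftrightarrow> admitted K p u' s' v' m" if "m < n" for m
    by (rule admitted_cong[of m]) (use assms that in auto)
  then show ?thesis
    unfolding present_def using assms(1) by auto
qed

text \<open>
  As long as the jobs in \<open>J\<close> are all still in service at the \<open>k\<close>-th arrival, their exact service
  times have had no influence on the admission decisions; this is what makes the residual
  service times memoryless.
\<close>

lemma admitted_prolong:
  assumes "\<And>i. 0 \<le> u i" "J \<subseteq> {..k}"
    and "\<And>m. m \<in> J \<Longrightarrow> arrival_time u k < arrival_time u m + s m"
    and "m \<le> k"
  shows "admitted K p u s v m \<longleftrightarrow>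
         admitted K p u (\<lambda>i. if i \<in> J then arrival_time u k - arrival_time u i + 1 else s i) v m"
proof (rule admitted_cong[OF _ _ \<open>m \<le> k\<close>])
  fix m i assume "m < i" "i \<le> k"
  then show "arrival_time u i < arrival_time u m + s m \<longleftrightarrow>
      arrival_time u i < arrival_time u m +
        (if m \<in> J then arrival_time u k - arrival_time u m + 1 else s m)"
    using assms(3)[of m] arrival_time_mono[of u i k] assms(1) by auto
qed simp

text \<open>Turns a binomial moment into a sum of indicators over a fixed finite family, so that
  expectations can be taken one subset at a time.\<close>

lemma choose_card_eq_sum:
  assumes "F \<subseteq> E" "finite E"
  shows "real (card F choose j) = (\<Sum>J | J \<subseteq> E \<and> card J = j. of_bool (J \<subseteq> F))"
proof -
  have "real (card F choose j) = real (card {J. J \<subseteq> F \<and> card J = j})"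
    using n_subsets[of F j] assms finite_subset by metis
  also have "\<dots> = (\<Sum>J \<in> {J. J \<subseteq> E \<and> card J = j} \<inter> {J. J \<subseteq> F}. 1)"
    using assms by (simp, intro arg_cong[where f = card]) auto
  also have "\<dots> = (\<Sum>J | J \<subseteq> E \<and> card J = j. of_bool (J \<subseteq> F))"
    using assms by (simp add: sum.inter_restrict of_bool_def del: sum_constant)
  finally show ?thesis .
qed

section \<open>Measurability of admissions and occupancy\<close>

lemma measurable_arrival_time [measurable]:
  assumes [measurable]: "\<And>i. (\<lambda>x. u x i) \<in> borel_measurable N"
  shows "(\<lambda>x. arrival_time (u x) n) \<in> borel_measurable N"
  unfolding arrival_time_def by measurable

lemma
  assumes [measurable]: "\<And>i. (\<lambda>x. u x i) \<in> borel_measurable N"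
    "\<And>i. (\<lambda>x. s x i) \<in> borel_measurable N" "\<And>i. (\<lambda>x. v x i) \<in> borel_measurable N"
  shows measurable_admitted [measurable]: "Measurable.pred N (\<lambda>x. admitted K p (u x) (s x) (v x) n)"
    and measurable_card_present [measurable]:
      "(\<lambda>x. card (present K p (u x) (s x) (v x) n)) \<in> measurable N (count_space UNIV)"
proof -
  \<comment> \<open>Given measurability of all earlier decisions, the occupancy is a finite sum of
    measurable indicators; strong induction on \<open>n\<close> then closes the recursion.\<close>
  have *: "(\<lambda>x. card (present K p (u x) (s x) (v x) n)) \<in> measurable N (count_space UNIV)"
    if "\<And>m. m < n \<Longrightarrow> Measurable.pred N (\<lambda>x. admitted K p (u x) (s x) (v x) m)" for n
  proof -
    have "card (present K p (u x) (s x) (v x) n) =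
            (\<Sum>m<n. of_bool (admitted K p (u x) (s x) (v x) m \<and>
              arrival_time (u x) n < arrival_time (u x) m + s x m))" for x
      unfolding present_def
      by (subst sum_of_bool_eq) (auto intro!: arg_cong[where f = card])
    moreover have "(\<lambda>x. (\<Sum>m<n. of_bool (admitted K p (u x) (s x) (v x) m \<and>
              arrival_time (u x) n < arrival_time (u x) m + s x m) :: nat))
        \<in> measurable N (count_space UNIV)"
    proof (rule measurable_sum_nat)
      fix m assume "m \<in> {..<n}"
      then have [measurable]: "Measurable.pred N (\<lambda>x. admitted K p (u x) (s x) (v x) m)"
        using that by simp
      show "(\<lambda>x. of_bool (admitted K p (u x) (s x) (v x) m \<and>
              arrival_time (u x) n < arrival_time (u x) m + s x m) :: nat)
        \<in> measurable N (count_space UNIV)"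
        unfolding of_bool_def by measurable
    qed
    ultimately show ?thesis
      by presburger
  qed
  have adm: "Measurable.pred N (\<lambda>x. admitted K p (u x) (s x) (v x) n)" for n
  proof (induction n rule: less_induct)
    case (less n)
    note [measurable] = *[OF less]
    show ?case
      unfolding admitted_iff by measurable
  qed
  show "Measurable.pred N (\<lambda>x. admitted K p (u x) (s x) (v x) n)"
    by (rule adm)
  show "(\<lambda>x. card (present K p (u x) (s x) (v x) n)) \<in> measurable N (count_space UNIV)"
    by (intro * adm)
qed

text \<open>
  For an index outside \<open>I\<close> the projection is constantly \<open>undefined\<close> on the space of the product
  measure.
\<close>

lemma borel_measurable_PiM_component:
  "(\<lambda>x. x i) \<in> borel_measurable (PiM I (\<lambda>_. borel :: real measure))"
proof (cases "i \<in> I")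
  case False
  have "(\<lambda>x. x i) \<in> borel_measurable (PiM I (\<lambda>_. borel :: real measure)) \<longleftrightarrow>
      (\<lambda>x. undefined :: real) \<in> borel_measurable (PiM I (\<lambda>_. borel :: real measure))"
  proof (rule measurable_cong)
    fix x assume "x \<in> space (PiM I (\<lambda>_. borel :: real measure))"
    then show "x i = undefined"
      using False unfolding space_PiM by (rule PiE_arb)
  qed
  then show ?thesis by simp
qed simp

subsection \<open>Memorylessness of the service times\<close>

context pricing_system
begin

text \<open>One family carries all primitives, so that disjoint blocks of coordinates, cut out by
  \<open>restrict\<close>, are independent.\<close>

definition Z :: "nat + nat + nat \<Rightarrow> 'a \<Rightarrow> real" where
  "Z = case_sum U (case_sum S V)"

abbreviation arr :: "nat \<Rightarrow> 'a \<Rightarrow> real" where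
  "arr n \<omega> \<equiv> arrival_time (\<lambda>i. U i \<omega>) n"

abbreviation adm :: "nat \<Rightarrow> real \<Rightarrow> nat \<Rightarrow> 'a \<Rightarrow> bool" where
  "adm K p n \<omega> \<equiv> admitted K p (\<lambda>i. U i \<omega>) (\<lambda>i. S i \<omega>) (\<lambda>i. V i \<omega>) n"

abbreviation pres :: "nat \<Rightarrow> real \<Rightarrow> nat \<Rightarrow> 'a \<Rightarrow> nat set" where
  "pres K p n \<omega> \<equiv> present K p (\<lambda>i. U i \<omega>) (\<lambda>i. S i \<omega>) (\<lambda>i. V i \<omega>) n"

abbreviation pres_after :: "nat \<Rightarrow> real \<Rightarrow> nat \<Rightarrow> 'a \<Rightarrow> nat set" where
  "pres_after K p n \<omega> \<equiv> present_after K p (\<lambda>i. U i \<omega>) (\<lambda>i. S i \<omega>) (\<lambda>i. V i \<omega>) n"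

abbreviation busy :: "nat \<Rightarrow> real \<Rightarrow> nat \<Rightarrow> 'a \<Rightarrow> nat" where
  "busy K p n \<omega> \<equiv> card (pres K p n \<omega>)"

lemma Z_simps [simp]: "Z (Inl i) = U i" "Z (Inr (Inl i)) = S i" "Z (Inr (Inr i)) = V i"
  by (simp_all add: Z_def)

lemma indep_Z: "indep_vars (\<lambda>_. borel) Z UNIV"
  using indep by (simp add: Z_def)

lemma measurable_Z [measurable]: "Z i \<in> borel_measurable M"
  using indep_Z by (simp add: indep_vars_def2)

lemma measurable_U [measurable]: "U i \<in> borel_measurable M"
  using measurable_Z[of "Inl i"] by simp

lemma measurable_S [measurable]: "S i \<in> borel_measurable M"
  using measurable_Z[of "Inr (Inl i)"] by simp

lemma measurable_V [measurable]: "V i \<in> borel_measurable M"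
  using measurable_Z[of "Inr (Inr i)"] by simp

lemma AE_U_nonneg: "AE \<omega> in M. \<forall>i. 0 \<le> U i \<omega>"
  using U_nonneg by (simp add: AE_all_countable)

lemma AE_S_pos: "AE \<omega> in M. \<forall>i. 0 < S i \<omega>"
proof -
  have "AE \<omega> in M. 0 < S i \<omega>" for i
  proof -
    have "prob {\<omega> \<in> space M. 0 < S i \<omega>} = 1"
      using exponential_distributedD_gt[OF S_exponential _ service_rate_pos, of 0 i] by simp
    from AE_prob_1[OF this] show ?thesis
      by (rule eventually_mono) simp
  qed
  then show ?thesis
    by (simp add: AE_all_countable)
qed

lemma prob_V_ge: "prob {\<omega> \<in> space M. p \<le> V k \<omega>} = measure G {p..}"
proof -
  have "measure (distr M borel (V k)) {p..} = prob {\<omega> \<in> space M. p \<le> V k \<omega>}"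
    by (subst measure_distr) (auto intro!: arg_cong[where f = prob])
  then show ?thesis
    by (simp add: V_law)
qed

lemma laplace_U: "laplace_stieltjes M (U k) s = laplace_stieltjes M (U 0) s"
proof -
  have "laplace_stieltjes M (U k) s = (\<integral>x. exp (- s * x) \<partial>distr M borel (U k))" for k
    unfolding laplace_stieltjes_def by (subst integral_distr) auto
  then show ?thesis
    using U_ident[of k] by simp
qed

text \<open>Independence gives a product of exponential tails; nonnegative thresholds keep each
  factor in the range of the tail formula.\<close>

lemma prob_S_gt:
  assumes "finite J" "\<And>m. m \<in> J \<Longrightarrow> 0 \<le> c m"
  shows "prob {\<omega> \<in> space M. \<forall>m\<in>J. c m < S m \<omega>} = exp (- \<mu> * (\<Sum>m\<in>J. c m))"
proof (cases "J = {}")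
  case True
  then show ?thesis by (simp add: prob_space)
next
  case False
  let ?e = "\<lambda>m. Inr (Inl m) :: nat + nat + nat"
  let ?A = "case_sum (\<lambda>_. UNIV) (case_sum (\<lambda>m. {c m<..}) (\<lambda>_. UNIV)) :: _ \<Rightarrow> real set"
  have inj: "inj_on ?e J"
    by (auto simp: inj_on_def)
  have "prob {\<omega> \<in> space M. \<forall>m\<in>J. c m < S m \<omega>} =
          prob (\<Inter>i\<in>?e ` J. Z i -` ?A i \<inter> space M)"
    using False by (intro arg_cong[where f = prob]) auto
  also have "\<dots> = (\<Prod>i\<in>?e ` J. prob (Z i -` ?A i \<inter> space M))"
    by (rule indep_varsD[OF indep_Z]) (use False assms in auto)
  also have "\<dots> = (\<Prod>m\<in>J. prob {\<omega> \<in> space M. c m < S m \<omega>})"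
    unfolding prod.reindex[OF inj]
    by (intro prod.cong refl) (auto intro!: arg_cong[where f = prob])
  also have "\<dots> = (\<Prod>m\<in>J. exp (- c m * \<mu>))"
    by (intro prod.cong refl exponential_distributedD_gt[OF S_exponential _ service_rate_pos] assms)
  also have "\<dots> = exp (- \<mu> * (\<Sum>m\<in>J. c m))"
    using assms(1) by (simp add: exp_sum[symmetric] sum_negf sum_distrib_left mult.commute)
  finally show ?thesis .
qed

text \<open>The restriction \<open>Y\<close> holds every coordinate except the service times of
  \<open>J\<close>, hence is independent of them. With \<open>Y\<close> fixed the thresholds are
  constants, and Fubini reduces the claim to the product of exponential tails.\<close>

lemma integral_exponential_tails:
  fixes J :: "nat set"
    and W :: "(nat + nat + nat \<Rightarrow> real) \<Rightarrow> bool"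
    and T :: "nat \<Rightarrow> (nat + nat + nat \<Rightarrow> real) \<Rightarrow> real"
  defines "B \<equiv> - (\<lambda>m. Inr (Inl m)) ` J"
  defines "Y \<equiv> \<lambda>\<omega>. restrict (\<lambda>i. Z i \<omega>) B"
  assumes J: "finite J"
    and W [measurable]: "Measurable.pred (PiM B (\<lambda>_. borel)) W"
    and T [measurable]: "\<And>m. T m \<in> borel_measurable (PiM B (\<lambda>_. borel))"
    and T_nonneg: "AE \<omega> in M. \<forall>m\<in>J. 0 \<le> T m (Y \<omega>)"
  shows "(\<integral>\<omega>. of_bool (W (Y \<omega>) \<and> (\<forall>m\<in>J. T m (Y \<omega>) < S m \<omega>)) \<partial>M) =
         (\<integral>\<omega>. of_bool (W (Y \<omega>)) * exp (- \<mu> * (\<Sum>m\<in>J. T m (Y \<omega>))) \<partial>M)"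
proof -
  define C :: "(nat + nat + nat) set" where "C = (\<lambda>m. Inr (Inl m)) ` J"
  define X where "X = (\<lambda>\<omega>. restrict (\<lambda>i. Z i \<omega>) C)"
  let ?NX = "PiM C (\<lambda>_. borel :: real measure)"
  let ?NY = "PiM B (\<lambda>_. borel :: real measure)"
  let ?f = "\<lambda>x y. of_bool (W y \<and> (\<forall>m\<in>J. T m y < x (Inr (Inl m)))) :: real"
  have indep: "indep_var ?NX X ?NY Y"
    unfolding X_def Y_def by (rule indep_var_restrict[OF indep_Z]) (auto simp: B_def C_def)
  note XY = indep[unfolded indep_var_distribution_eq]
  have [measurable]: "X \<in> measurable M ?NX" "Y \<in> measurable M ?NY"
    using XY by auto
  interpret X: prob_space "distr M ?NX X" by (rule prob_space_distr) simp
  interpret Y: prob_space "distr M ?NY Y" by (rule prob_space_distr) simp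
  interpret XY: pair_prob_space "distr M ?NX X" "distr M ?NY Y" ..
  have [measurable]: "(\<lambda>x. x (Inr (Inl m))) \<in> borel_measurable ?NX" for m
    by (rule borel_measurable_PiM_component)
  have f [measurable]: "case_prod ?f \<in> borel_measurable (?NX \<Otimes>\<^sub>M ?NY)"
    using J by measurable
  have f': "case_prod ?f \<in> borel_measurable (distr M ?NX X \<Otimes>\<^sub>M distr M ?NY Y)"
    using f by (simp cong: measurable_cong_sets sets_pair_measure_cong)
  have "(\<integral>\<omega>. of_bool (W (Y \<omega>) \<and> (\<forall>m\<in>J. T m (Y \<omega>) < S m \<omega>)) \<partial>M) =
          (\<integral>\<omega>. case_prod ?f (X \<omega>, Y \<omega>) \<partial>M)"
    by (intro Bochner_Integration.integral_cong refl) (auto simp: X_def C_def)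
  also have "\<dots> = (\<integral>z. case_prod ?f z \<partial>distr M (?NX \<Otimes>\<^sub>M ?NY) (\<lambda>\<omega>. (X \<omega>, Y \<omega>)))"
    by (subst integral_distr) auto
  also have "\<dots> = (\<integral>z. case_prod ?f z \<partial>(distr M ?NX X \<Otimes>\<^sub>M distr M ?NY Y))"
    using XY by simp
  also have "\<dots> = (\<integral>y. (\<integral>x. ?f x y \<partial>distr M ?NX X) \<partial>distr M ?NY Y)"
    by (rule XY.integral_snd[symmetric], rule XY.integrable_const_bound[where B = 1])
       (auto intro: f')
  also have "\<dots> = (\<integral>y. of_bool (W y) * exp (- \<mu> * (\<Sum>m\<in>J. T m y)) \<partial>distr M ?NY Y)"
  proof (rule integral_cong_AE)
    have "(\<lambda>(y, x). ?f x y) \<in> borel_measurable (?NY \<Otimes>\<^sub>M distr M ?NX X)"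
      using J by measurable
    from X.borel_measurable_lebesgue_integral[OF this]
    show "(\<lambda>y. \<integral>x. ?f x y \<partial>distr M ?NX X) \<in> borel_measurable (distr M ?NY Y)"
      by simp
    show "(\<lambda>y. of_bool (W y) * exp (- \<mu> * (\<Sum>m\<in>J. T m y))) \<in> borel_measurable (distr M ?NY Y)"
      by simp
    \<comment> \<open>The thresholds are nonnegative only almost surely, so this is first moved to
      the law of \<open>Y\<close>, over which the outer integral runs.\<close>
    have "AE y in distr M ?NY Y. \<forall>m\<in>J. 0 \<le> T m y"
      using T_nonneg J by (subst AE_distr_iff) auto
    then show "AE y in distr M ?NY Y. (\<integral>x. ?f x y \<partial>distr M ?NX X) =
        of_bool (W y) * exp (- \<mu> * (\<Sum>m\<in>J. T m y))"
    proof (rule AE_mp, intro AE_I2 impI)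
      fix y assume "y \<in> space (distr M ?NY Y)" and T0: "\<forall>m\<in>J. 0 \<le> T m y"
      have "(\<integral>x. ?f x y \<partial>distr M ?NX X) = (\<integral>\<omega>. ?f (X \<omega>) y \<partial>M)"
      proof (rule integral_distr)
        show "(\<lambda>x. ?f x y) \<in> borel_measurable ?NX"
          using J by measurable
      qed simp
      also have "\<dots> = (\<integral>\<omega>. of_bool (W y) *
          indicator {\<omega> \<in> space M. \<forall>m\<in>J. T m y < S m \<omega>} \<omega> \<partial>M)"
        by (intro Bochner_Integration.integral_cong refl) (auto simp: X_def C_def indicator_def)
      also have "\<dots> = of_bool (W y) * prob {\<omega> \<in> space M. \<forall>m\<in>J. T m y < S m \<omega>}"
        by (simp add: Int_absorb1 Int_absorb2 subset_iff)
      also have "prob {\<omega> \<in> space M. \<forall>m\<in>J. T m y < S m \<omega>} = exp (- \<mu> * (\<Sum>m\<in>J. T m y))"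
        using J T0 by (intro prob_S_gt) auto
      finally show "(\<integral>x. ?f x y \<partial>distr M ?NX X) =
          of_bool (W y) * exp (- \<mu> * (\<Sum>m\<in>J. T m y))" .
    qed
  qed
  also have "\<dots> = (\<integral>\<omega>. of_bool (W (Y \<omega>)) * exp (- \<mu> * (\<Sum>m\<in>J. T m (Y \<omega>))) \<partial>M)"
    by (subst integral_distr) auto
  finally show ?thesis .
qed

text \<open>Coordinate \<open>i\<close> is independent of all others together; this product rule is
  used to split off one fresh variable.\<close>

lemma expectation_coordinate_mult:
  fixes f :: "real \<Rightarrow> real" and g :: "(nat + nat + nat \<Rightarrow> real) \<Rightarrow> real"
  assumes [measurable]: "f \<in> borel_measurable borel" "g \<in> borel_measurable (PiM (- {i}) (\<lambda>_. borel))"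
    and "integrable M (\<lambda>\<omega>. f (Z i \<omega>))"
    and "integrable M (\<lambda>\<omega>. g (restrict (\<lambda>j. Z j \<omega>) (- {i})))"
  shows "(\<integral>\<omega>. f (Z i \<omega>) * g (restrict (\<lambda>j. Z j \<omega>) (- {i})) \<partial>M) =
         (\<integral>\<omega>. f (Z i \<omega>) \<partial>M) * (\<integral>\<omega>. g (restrict (\<lambda>j. Z j \<omega>) (- {i})) \<partial>M)"
proof -
  have "indep_var (PiM {i} (\<lambda>_. borel)) (\<lambda>\<omega>. restrict (\<lambda>j. Z j \<omega>) {i})
          (PiM (- {i}) (\<lambda>_. borel)) (\<lambda>\<omega>. restrict (\<lambda>j. Z j \<omega>) (- {i}))"
    by (rule indep_var_restrict[OF indep_Z]) auto
  then have "indep_var borel ((\<lambda>x. f (x i)) \<circ> (\<lambda>\<omega>. restrict (\<lambda>j. Z j \<omega>) {i}))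
          borel (g \<circ> (\<lambda>\<omega>. restrict (\<lambda>j. Z j \<omega>) (- {i})))"
    by (rule indep_var_compose) (auto intro: assms measurable_compose[OF measurable_component_singleton])
  then have *: "indep_var borel (\<lambda>\<omega>. f (Z i \<omega>)) borel (\<lambda>\<omega>. g (restrict (\<lambda>j. Z j \<omega>) (- {i})))"
    by (simp add: comp_def)
  show ?thesis
    by (rule indep_var_lebesgue_integral[OF * assms(3,4)])
qed

text \<open>An arbitrary \<open>g\<close> is allowed: job \<open>k\<close> has only \<open>k\<close>
  predecessors, so at most the values \<open>g 0\<close> to \<open>g k\<close> occur, and this on
  every path.\<close>

lemma integrable_of_bool_busy:
  fixes g :: "nat \<Rightarrow> real"
  assumes [measurable]: "Measurable.pred M P"
  shows "integrable M (\<lambda>\<omega>. of_bool (P \<omega>) * g (busy K p k \<omega>))"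
proof (rule integrable_const_bound)
  show "AE \<omega> in M. norm (of_bool (P \<omega>) * g (busy K p k \<omega>)) \<le> (\<Sum>i\<le>k. \<bar>g i\<bar>)"
  proof (rule AE_I2)
    fix \<omega>
    have "busy K p k \<omega> \<le> card {..<k}"
      by (rule card_mono) (auto simp: present_def)
    then have "\<bar>g (busy K p k \<omega>)\<bar> \<le> (\<Sum>i\<le>k. \<bar>g i\<bar>)"
      by (intro member_le_sum[where f = "\<lambda>i. \<bar>g i\<bar>"]) auto
    then show "norm (of_bool (P \<omega>) * g (busy K p k \<omega>)) \<le> (\<Sum>i\<le>k. \<bar>g i\<bar>)"
      by (auto simp: sum_nonneg)
  qed
  have [measurable]: "(\<lambda>\<omega>. g (busy K p k \<omega>)) \<in> borel_measurable M"
    by (rule measurable_compose[OF measurable_card_present]) auto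
  show "(\<lambda>\<omega>. of_bool (P \<omega>) * g (busy K p k \<omega>)) \<in> borel_measurable M"
    by measurable
qed

text \<open>The arrival time of job \<open>k\<close> and the state it finds are functions of the
  coordinates other than \<open>V k\<close>.\<close>

lemma expectation_valuation_busy:
  fixes g :: "nat \<Rightarrow> real"
  shows "(\<integral>\<omega>. of_bool (arr k \<omega> \<le> t \<and> p \<le> V k \<omega>) * g (busy K p k \<omega>) \<partial>M) =
         measure G {p..} * (\<integral>\<omega>. of_bool (arr k \<omega> \<le> t) * g (busy K p k \<omega>) \<partial>M)"
proof -
  let ?i = "Inr (Inr k) :: nat + nat + nat"
  define f :: "real \<Rightarrow> real" where "f = (\<lambda>x. of_bool (p \<le> x))"
  define h :: "(nat + nat + nat \<Rightarrow> real) \<Rightarrow> real" where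
    "h = (\<lambda>y. of_bool (arrival_time (\<lambda>i. y (Inl i)) k \<le> t) *
       g (card (present K p (\<lambda>i. y (Inl i)) (\<lambda>i. y (Inr (Inl i))) (\<lambda>i. y (Inr (Inr i))) k)))"
  have [measurable]: "f \<in> borel_measurable borel"
    unfolding f_def by measurable
  have [measurable]: "(\<lambda>y. y i) \<in> borel_measurable (PiM (- {?i}) (\<lambda>_. borel :: real measure))" for i
    by (rule borel_measurable_PiM_component)
  have [measurable]: "(\<lambda>y. g (card (present K p (\<lambda>i. y (Inl i)) (\<lambda>i. y (Inr (Inl i)))
      (\<lambda>i. y (Inr (Inr i))) k))) \<in> borel_measurable (PiM (- {?i}) (\<lambda>_. borel))"
    by (rule measurable_compose[OF measurable_card_present]) auto
  have [measurable]: "h \<in> borel_measurable (PiM (- {?i}) (\<lambda>_. borel))"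
    unfolding h_def by measurable
  have h: "h (restrict (\<lambda>j. Z j \<omega>) (- {?i})) = of_bool (arr k \<omega> \<le> t) * g (busy K p k \<omega>)" for \<omega>
  proof -
    \<comment> \<open>Restriction replaces \<open>V k\<close> by \<open>undefined\<close>; this is
      harmless because the state found by job \<open>k\<close> reads only earlier
      valuations.\<close>
    have "present K p (\<lambda>i. U i \<omega>) (\<lambda>i. S i \<omega>)
        (\<lambda>i. restrict (\<lambda>j. Z j \<omega>) (- {?i}) (Inr (Inr i))) k = pres K p k \<omega>"
      by (rule present_cong) auto
    then show ?thesis
      by (simp add: h_def)
  qed
  have "(\<integral>\<omega>. of_bool (arr k \<omega> \<le> t \<and> p \<le> V k \<omega>) * g (busy K p k \<omega>) \<partial>M) =
      (\<integral>\<omega>. f (Z ?i \<omega>) * h (restrict (\<lambda>j. Z j \<omega>) (- {?i})) \<partial>M)"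
    unfolding h by (intro Bochner_Integration.integral_cong refl) (auto simp: f_def)
  also have "\<dots> = (\<integral>\<omega>. f (Z ?i \<omega>) \<partial>M) * (\<integral>\<omega>. h (restrict (\<lambda>j. Z j \<omega>) (- {?i})) \<partial>M)"
  proof (rule expectation_coordinate_mult)
    show "integrable M (\<lambda>\<omega>. f (Z ?i \<omega>))"
      by (rule integrable_const_bound[where B = 1]) (auto simp: f_def)
    show "integrable M (\<lambda>\<omega>. h (restrict (\<lambda>j. Z j \<omega>) (- {?i})))"
      unfolding h by (rule integrable_of_bool_busy) measurable
  qed measurable
  also have "(\<integral>\<omega>. f (Z ?i \<omega>) \<partial>M) = (\<integral>\<omega>. indicator {\<omega> \<in> space M. p \<le> V k \<omega>} \<omega> \<partial>M)"
    by (intro Bochner_Integration.integral_cong refl) (auto simp: f_def indicator_def)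
  also have "\<dots> = measure G {p..}"
    using prob_V_ge[of p k] by (simp add: Int_absorb1 Int_absorb2 subset_iff)
  finally show ?thesis
    unfolding h .
qed

lemma pred_subset_present:
  assumes "finite J"
  shows "Measurable.pred M (\<lambda>\<omega>. J \<subseteq> pres K p n \<omega>)"
proof -
  have "(\<lambda>\<omega>. J \<subseteq> pres K p n \<omega>) =
      (\<lambda>\<omega>. \<forall>m\<in>J. m < n \<and> adm K p m \<omega> \<and> arr n \<omega> < arr m \<omega> + S m \<omega>)"
    by (auto simp: present_def)
  then show ?thesis
    using assms by simp
qed

lemma pred_subset_present_after:
  assumes "finite J"
  shows "Measurable.pred M (\<lambda>\<omega>. J \<subseteq> pres_after K p n \<omega>)"
proof -
  have "(\<lambda>\<omega>. J \<subseteq> pres_after K p n \<omega>) =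
      (\<lambda>\<omega>. \<forall>m\<in>J. m \<le> n \<and> adm K p m \<omega> \<and> arr n \<omega> < arr m \<omega> + S m \<omega>)"
    by (auto simp: present_after_def)
  then show ?thesis
    using assms by simp
qed

text \<open>Given the other coordinates, the jobs of \<open>J\<close> outlast arrival
  \<open>Suc k\<close> with probability \<open>exp\<close> of minus \<open>\<mu>\<close> times the
  sum of their ages at that time. Each age has grown by \<open>U (Suc k)\<close> since arrival
  \<open>k\<close>, which splits off an independent factor whose mean is the transform at
  \<open>card J * \<mu>\<close>. What remains is the same tail formula at arrival
  \<open>k\<close>.\<close>

lemma prob_subset_present_Suc:
  assumes J: "J \<subseteq> {..k}"
  shows "(\<integral>\<omega>. of_bool (arr k \<omega> \<le> t \<and> J \<subseteq> pres K p (Suc k) \<omega>) \<partial>M) =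
         laplace_stieltjes M (U 0) (real (card J) * \<mu>) *
         (\<integral>\<omega>. of_bool (arr k \<omega> \<le> t \<and> J \<subseteq> pres_after K p k \<omega>) \<partial>M)"
proof -
  define B :: "(nat + nat + nat) set" where "B = - (\<lambda>m. Inr (Inl m)) ` J"
  define Y where "Y = (\<lambda>\<omega>. restrict (\<lambda>i. Z i \<omega>) B)"
  define u :: "(nat + nat + nat \<Rightarrow> real) \<Rightarrow> nat \<Rightarrow> real" where "u = (\<lambda>y i. y (Inl i))"
  \<comment> \<open>Surrogate path: jobs in \<open>J\<close> get a service ending one unit after
    arrival \<open>k\<close>, so their true service times, which are missing from \<open>Y\<close>,
    are never read. The \<open>1\<close> secures the strict inequality.\<close>
  define s :: "(nat + nat + nat \<Rightarrow> real) \<Rightarrow> nat \<Rightarrow> real" where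
    "s = (\<lambda>y i. if i \<in> J then arrival_time (u y) k - arrival_time (u y) i + 1 else y (Inr (Inl i)))"
  define v :: "(nat + nat + nat \<Rightarrow> real) \<Rightarrow> nat \<Rightarrow> real" where "v = (\<lambda>y i. y (Inr (Inr i)))"
  define W where "W = (\<lambda>y. arrival_time (u y) k \<le> t \<and> (\<forall>m\<in>J. admitted K p (u y) (s y) (v y) m))"
  \<comment> \<open>\<open>T l m\<close> is the age of job \<open>m\<close> at arrival
    \<open>l\<close>; it is used with \<open>l = k\<close> and \<open>l = Suc k\<close>.\<close>
  define T where "T = (\<lambda>l m y. arrival_time (u y) l - arrival_time (u y) m)"
  have fin: "finite J"
    using J finite_subset by blast
  have u_meas: "(\<lambda>y. u y i) \<in> borel_measurable (PiM I (\<lambda>_. borel))" for i I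
    unfolding u_def by (rule borel_measurable_PiM_component)
  have s_meas: "(\<lambda>y. s y i) \<in> borel_measurable (PiM I (\<lambda>_. borel))" for i I
    unfolding s_def using borel_measurable_PiM_component[of "Inr (Inl i)" I] u_meas[of _ I]
    by measurable
  have v_meas: "(\<lambda>y. v y i) \<in> borel_measurable (PiM I (\<lambda>_. borel))" for i I
    unfolding v_def by (rule borel_measurable_PiM_component)
  have W_meas: "Measurable.pred (PiM I (\<lambda>_. borel)) W" for I
  proof -
    note [measurable] = u_meas[of _ I] s_meas[of _ I] v_meas[of _ I]
    show ?thesis
      unfolding W_def using fin by measurable
  qed
  have T_meas: "T l m \<in> borel_measurable (PiM I (\<lambda>_. borel))" for l m I
    unfolding T_def using u_meas[of _ I] by measurable
  have Y_meas: "Y \<in> measurable M (PiM B (\<lambda>_. borel))"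
    unfolding Y_def by measurable
  have [measurable]: "Measurable.pred M (\<lambda>\<omega>. W (Y \<omega>))"
    by (rule measurable_compose[OF Y_meas W_meas])
  have [measurable]: "(\<lambda>\<omega>. T l m (Y \<omega>)) \<in> borel_measurable M" for l m
    by (rule measurable_compose[OF Y_meas T_meas])
  note [measurable] = pred_subset_present[OF fin] pred_subset_present_after[OF fin]
  have uY: "u (Y \<omega>) = (\<lambda>i. U i \<omega>)" and vY: "v (Y \<omega>) = (\<lambda>i. V i \<omega>)" for \<omega>
    by (auto simp: u_def v_def Y_def B_def)
  have sY: "s (Y \<omega>) = (\<lambda>i. if i \<in> J then arr k \<omega> - arr i \<omega> + 1 else S i \<omega>)" for \<omega>
    unfolding s_def uY by (auto simp: Y_def B_def fun_eq_iff)
  have T_nonneg: "AE \<omega> in M. \<forall>m\<in>J. 0 \<le> T l m (Y \<omega>)" if "k \<le> l" for l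
    using AE_U_nonneg
  proof eventually_elim
    case (elim \<omega>)
    then show ?case
      using arrival_time_mono[of "\<lambda>i. U i \<omega>" _ l] J that by (fastforce simp: T_def uY)
  qed
  \<comment> \<open>On the event that all of \<open>J\<close> outlast arrival \<open>l\<close>, and
    hence arrival \<open>k\<close>, surrogate and true decisions agree by
    \<open>admitted_prolong\<close>.\<close>
  have admitted_W: "admitted K p (u (Y \<omega>)) (s (Y \<omega>)) (v (Y \<omega>)) m = adm K p m \<omega>"
    if "\<forall>i. 0 \<le> U i \<omega>" "\<forall>m\<in>J. T l m (Y \<omega>) < S m \<omega>" "k \<le> l" "m \<in> J" for \<omega> m l
  proof -
    have "arr k \<omega> \<le> arr l \<omega>"
      using that by (intro arrival_time_mono) auto
    then have "arr k \<omega> < arr m \<omega> + S m \<omega>" if "m \<in> J" for m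
      using \<open>\<forall>m\<in>J. T l m (Y \<omega>) < S m \<omega>\<close> that by (fastforce simp: T_def uY)
    then show ?thesis
      unfolding uY vY sY using that J by (intro admitted_prolong[symmetric]) auto
  qed
  have tails: "(\<integral>\<omega>. of_bool (W (Y \<omega>) \<and> (\<forall>m\<in>J. T l m (Y \<omega>) < S m \<omega>)) \<partial>M) =
      (\<integral>\<omega>. of_bool (W (Y \<omega>)) * exp (- \<mu> * (\<Sum>m\<in>J. T l m (Y \<omega>))) \<partial>M)" if "k \<le> l" for l
    unfolding Y_def B_def
    by (intro integral_exponential_tails fin W_meas T_meas)
       (rule T_nonneg[OF that, unfolded Y_def B_def])
  have "(\<integral>\<omega>. (of_bool (arr k \<omega> \<le> t \<and> J \<subseteq> pres K p (Suc k) \<omega>) :: real) \<partial>M) =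
      (\<integral>\<omega>. of_bool (W (Y \<omega>) \<and> (\<forall>m\<in>J. T (Suc k) m (Y \<omega>) < S m \<omega>)) \<partial>M)"
  proof (rule integral_cong_AE)
    show "AE \<omega> in M. of_bool (arr k \<omega> \<le> t \<and> J \<subseteq> pres K p (Suc k) \<omega>) =
        (of_bool (W (Y \<omega>) \<and> (\<forall>m\<in>J. T (Suc k) m (Y \<omega>) < S m \<omega>)) :: real)"
      using AE_U_nonneg
    proof eventually_elim
      case (elim \<omega>)
      have "J \<subseteq> pres K p (Suc k) \<omega> \<longleftrightarrow>
          (\<forall>m\<in>J. adm K p m \<omega>) \<and> (\<forall>m\<in>J. T (Suc k) m (Y \<omega>) < S m \<omega>)"
        using J by (auto simp: present_def T_def uY)
      then show ?case
        using admitted_W[OF elim, of "Suc k"] by (auto simp: W_def uY)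
    qed
  qed (use fin in measurable, use fin in measurable)
  also have "\<dots> = (\<integral>\<omega>. of_bool (W (Y \<omega>)) * exp (- \<mu> * (\<Sum>m\<in>J. T (Suc k) m (Y \<omega>))) \<partial>M)"
    by (rule tails) simp
  also have "\<dots> = laplace_stieltjes M (U 0) (real (card J) * \<mu>) *
      (\<integral>\<omega>. of_bool (W (Y \<omega>)) * exp (- \<mu> * (\<Sum>m\<in>J. T k m (Y \<omega>))) \<partial>M)"
  proof -
    let ?i = "Inl (Suc k) :: nat + nat + nat"
    define f where "f = (\<lambda>x. exp (- (real (card J) * \<mu>) * x))"
    define g where "g = (\<lambda>y. of_bool (W y) * exp (- \<mu> * (\<Sum>m\<in>J. T k m y)))"
    have [measurable]: "f \<in> borel_measurable borel"
      unfolding f_def by measurable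
    have g_meas: "g \<in> borel_measurable (PiM I (\<lambda>_. borel))" for I
      unfolding g_def using W_meas[of I] T_meas[of _ _ I] by measurable
    \<comment> \<open>Dropping \<open>U (Suc k)\<close> leaves \<open>g\<close> unchanged, because
      it looks only at arrivals, services and valuations of jobs up to \<open>k\<close>.\<close>
    have g: "g (restrict (\<lambda>j. Z j \<omega>) (- {?i})) = g (Y \<omega>)" for \<omega>
    proof -
      let ?y = "restrict (\<lambda>j. Z j \<omega>) (- {?i})"
      have arr_eq: "arrival_time (u ?y) l = arr l \<omega>" if "l \<le> k" for l
        unfolding arrival_time_def u_def using that by (intro sum.cong) auto
      have s_eq: "s ?y m = s (Y \<omega>) m" if "m \<le> k" for m
        unfolding sY using that by (auto simp: s_def arr_eq)
      have "admitted K p (u ?y) (s ?y) (v ?y) m = admitted K p (u (Y \<omega>)) (s (Y \<omega>)) (v (Y \<omega>)) m"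
        if "m \<le> k" for m
        by (rule admitted_cong[OF _ _ that]) (auto simp: arr_eq s_eq uY vY, auto simp: v_def)
      moreover have "T k m ?y = T k m (Y \<omega>)" if "m \<le> k" for m
        using that by (simp add: T_def arr_eq uY)
      ultimately show ?thesis
        using J by (auto simp: g_def W_def arr_eq uY subset_iff intro!: sum.cong)
    qed
    have [measurable]: "(\<lambda>\<omega>. g (Y \<omega>)) \<in> borel_measurable M"
      by (rule measurable_compose[OF Y_meas g_meas])
    have g_int: "integrable M (\<lambda>\<omega>. g (Y \<omega>))"
    proof (rule integrable_const_bound[where B = 1])
      show "AE \<omega> in M. norm (g (Y \<omega>)) \<le> 1"
        using T_nonneg[OF order_refl]
      proof eventually_elim
        case (elim \<omega>)
        then show ?case
          using service_rate_pos by (auto simp: g_def sum_nonneg)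
      qed
    qed measurable
    have f_int: "integrable M (\<lambda>\<omega>. f (Z ?i \<omega>))"
    proof (rule integrable_const_bound[where B = 1])
      show "AE \<omega> in M. norm (f (Z ?i \<omega>)) \<le> 1"
        using AE_U_nonneg
        by eventually_elim (use service_rate_pos in \<open>auto simp: f_def\<close>)
    qed measurable
    have "of_bool (W (Y \<omega>)) * exp (- \<mu> * (\<Sum>m\<in>J. T (Suc k) m (Y \<omega>))) =
        f (Z ?i \<omega>) * g (restrict (\<lambda>j. Z j \<omega>) (- {?i}))" for \<omega>
    proof -
      have "(\<Sum>m\<in>J. T (Suc k) m (Y \<omega>)) = (\<Sum>m\<in>J. U (Suc k) \<omega> + T k m (Y \<omega>))"
        by (intro sum.cong) (simp_all add: T_def arrival_time_Suc uY)
      also have "\<dots> = real (card J) * U (Suc k) \<omega> + (\<Sum>m\<in>J. T k m (Y \<omega>))"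
        by (simp add: sum.distrib)
      finally have "exp (- \<mu> * (\<Sum>m\<in>J. T (Suc k) m (Y \<omega>))) =
          f (Z ?i \<omega>) * exp (- \<mu> * (\<Sum>m\<in>J. T k m (Y \<omega>)))"
        by (simp add: f_def exp_add[symmetric] algebra_simps)
      then show ?thesis
        unfolding g by (simp add: g_def)
    qed
    then have "(\<integral>\<omega>. of_bool (W (Y \<omega>)) * exp (- \<mu> * (\<Sum>m\<in>J. T (Suc k) m (Y \<omega>))) \<partial>M) =
        (\<integral>\<omega>. f (Z ?i \<omega>) * g (restrict (\<lambda>j. Z j \<omega>) (- {?i})) \<partial>M)"
      by simp
    also have "\<dots> = (\<integral>\<omega>. f (Z ?i \<omega>) \<partial>M) * (\<integral>\<omega>. g (restrict (\<lambda>j. Z j \<omega>) (- {?i})) \<partial>M)"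
    proof (rule expectation_coordinate_mult)
      show "integrable M (\<lambda>\<omega>. g (restrict (\<lambda>j. Z j \<omega>) (- {?i})))"
        unfolding g by (rule g_int)
    qed (use f_int g_meas in auto)
    also have "(\<integral>\<omega>. f (Z ?i \<omega>) \<partial>M) = laplace_stieltjes M (U 0) (real (card J) * \<mu>)"
      unfolding laplace_U[of "Suc k", symmetric] by (simp add: f_def laplace_stieltjes_def)
    finally show ?thesis
      unfolding g by (simp add: g_def)
  qed
  \<comment> \<open>The tail identity is now read backwards at \<open>l = k\<close>, restoring the
    event about the state just after arrival \<open>k\<close>.\<close>
  also have "(\<integral>\<omega>. of_bool (W (Y \<omega>)) * exp (- \<mu> * (\<Sum>m\<in>J. T k m (Y \<omega>))) \<partial>M) =
      (\<integral>\<omega>. of_bool (W (Y \<omega>) \<and> (\<forall>m\<in>J. T k m (Y \<omega>) < S m \<omega>)) \<partial>M)"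
    by (rule tails[symmetric]) simp
  also have "\<dots> = (\<integral>\<omega>. of_bool (arr k \<omega> \<le> t \<and> J \<subseteq> pres_after K p k \<omega>) \<partial>M)"
  proof (rule integral_cong_AE)
    show "AE \<omega> in M. (of_bool (W (Y \<omega>) \<and> (\<forall>m\<in>J. T k m (Y \<omega>) < S m \<omega>)) :: real) =
        of_bool (arr k \<omega> \<le> t \<and> J \<subseteq> pres_after K p k \<omega>)"
      using AE_U_nonneg
    proof eventually_elim
      case (elim \<omega>)
      have "J \<subseteq> pres_after K p k \<omega> \<longleftrightarrow>
          (\<forall>m\<in>J. adm K p m \<omega>) \<and> (\<forall>m\<in>J. T k m (Y \<omega>) < S m \<omega>)"
        using J by (auto simp: present_after_def T_def uY)
      then show ?case
        using admitted_W[OF elim, of k] by (auto simp: W_def uY)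
    qed
  qed (use fin in measurable, use fin in measurable)
  finally show ?thesis .
qed

end

subsection \<open>The Poisson equation\<close>

text \<open>Here \<open>f j\<close> stands for the transform at \<open>j * \<mu>\<close>, with
  \<open>j\<close> starting at 1, and \<open>q\<close> for the probability of accepting the price.
  For \<open>q = 1\<close> these are the products in Takacs's loss formula for renewal arrivals and
  exponential service.\<close>

definition takacs_weight :: "(nat \<Rightarrow> real) \<Rightarrow> real \<Rightarrow> nat \<Rightarrow> real" where
  "takacs_weight f q i = (\<Prod>j<i. (1 - f (Suc j)) / (q * f (Suc j)))"

definition takacs_sum :: "(nat \<Rightarrow> real) \<Rightarrow> real \<Rightarrow> nat \<Rightarrow> real" where
  "takacs_sum f q K = (\<Sum>i\<le>K. takacs_weight f q i * real (K choose i))"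

text \<open>The coefficients are chosen to make the drift telescope: below \<open>K\<close>, the
  gain from term \<open>Suc i\<close> cancels the loss from term \<open>i\<close>.\<close>

definition poisson_sol :: "(nat \<Rightarrow> real) \<Rightarrow> real \<Rightarrow> nat \<Rightarrow> nat \<Rightarrow> real" where
  "poisson_sol f q K x =
     (\<Sum>i<K. takacs_weight f q i / (q * f (Suc i)) * real (x choose Suc i))"

lemma poisson_equation:
  assumes "x \<le> K" "q \<noteq> 0" "\<And>i. f (Suc i) \<noteq> 0"
  shows "(\<Sum>i<K. takacs_weight f q i / (q * f (Suc i)) *
           (f (Suc i) * (real (x choose Suc i) + q * (of_bool (x < K) * real (x choose i)))
              - real (x choose Suc i)))
         = 1 - takacs_sum f q K * of_bool (x = K)"
proof -
  let ?w = "takacs_weight f q"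
  have Suc: "?w (Suc i) = ?w i * ((1 - f (Suc i)) / (q * f (Suc i)))" for i
    by (simp add: takacs_weight_def)
  \<comment> \<open>By the recursion for the weights, the coefficient of
    \<open>x choose Suc i\<close> collapses to minus the next weight.\<close>
  have "?w i / (q * f (Suc i)) * (f (Suc i) * (real (x choose Suc i) + q * (b * real (x choose i)))
      - real (x choose Suc i)) = b * (?w i * real (x choose i)) - ?w (Suc i) * real (x choose Suc i)" for i b
    unfolding Suc using assms(2) assms(3)[of i] by (simp add: field_simps)
  then have *: "(\<Sum>i<K. ?w i / (q * f (Suc i)) *
           (f (Suc i) * (real (x choose Suc i) + q * (of_bool (x < K) * real (x choose i)))
              - real (x choose Suc i))) =
      (\<Sum>i<K. of_bool (x < K) * (?w i * real (x choose i)) - ?w (Suc i) * real (x choose Suc i))"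
    by simp
  show ?thesis
  proof (cases "x < K")
    case True
    \<comment> \<open>The sum telescopes to its first term 1, because \<open>x choose K = 0\<close>
      for \<open>x < K\<close>.\<close>
    then show ?thesis
      unfolding * using sum_lessThan_telescope'[of "\<lambda>i. ?w i * real (x choose i)" K]
      by (simp add: takacs_weight_def)
  next
    case False
    \<comment> \<open>Admission is off in this state, so what remains is minus the terms of
      \<open>takacs_sum\<close> with positive index; its index 0 term is 1.\<close>
    then have "x = K" using assms(1) by simp
    then show ?thesis
      unfolding * by (simp add: takacs_sum_def sum.atMost_shift takacs_weight_def[of f q 0] sum_negf)
  qed
qed

text \<open>\<open>P\<close> holds on an initial segment, so the sum stops at some index
  \<open>m\<close> and equals \<open>g m - g 0\<close>.\<close>

lemma antimono_telescope_bound: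
  fixes g :: "nat \<Rightarrow> real"
  assumes "\<And>k. P (Suc k) \<Longrightarrow> P k" "\<And>k. \<bar>g k\<bar> \<le> H"
  shows "\<bar>\<Sum>k<n. of_bool (P k) * (g (Suc k) - g k)\<bar> \<le> 2 * H"
proof -
  \<comment> \<open>The clause \<open>P n \<longrightarrow> m = n\<close> keeps the stopped index
    current, so that the next increment attaches to it.\<close>
  have "\<exists>m. (\<Sum>k<n. of_bool (P k) * (g (Suc k) - g k)) = g m - g 0 \<and> (P n \<longrightarrow> m = n)"
  proof (induction n)
    case (Suc n)
    then obtain m where m: "(\<Sum>k<n. of_bool (P k) * (g (Suc k) - g k)) = g m - g 0" "P n \<longrightarrow> m = n"
      by blast
    then show ?case
      using assms(1)[of n] by (cases "P n") auto
  qed auto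
  then obtain m where "(\<Sum>k<n. of_bool (P k) * (g (Suc k) - g k)) = g m - g 0"
    by blast
  then show ?thesis
    using assms(2)[of m] assms(2)[of 0] by linarith
qed

text \<open>The sum can overshoot \<open>t\<close> only by the last counted gap, which truncation
  caps at \<open>c\<close>. The induction also carries the bound by the arrival time.\<close>

lemma truncated_partial_sum_le:
  fixes u :: "nat \<Rightarrow> real"
  assumes "\<And>i. 0 \<le> u i" "0 \<le> t"
  shows "min (u 0) c + (\<Sum>k<n. of_bool (arrival_time u k \<le> t) * min (u (Suc k)) c) \<le> t + c"
proof -
  have "min (u 0) c + (\<Sum>k<n. of_bool (arrival_time u k \<le> t) * min (u (Suc k)) c) \<le>
      min (arrival_time u n) (t + c)"
  proof (induction n)
    case 0
    then show ?case using assms by (auto simp: arrival_time_def)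
  next
    case (Suc n)
    then show ?case
      using assms(1)[of "Suc n"] assms(2)
      by (cases "arrival_time u n \<le> t") (auto simp: arrival_time_Suc min_def split: if_splits)
  qed
  then show ?thesis by simp
qed

text \<open>The sum runs up to the first arrival after \<open>t\<close>, so it reaches
  \<open>t\<close> unless all arrivals up to \<open>n\<close> occur by time \<open>t\<close>; in
  that case the left side is 0.\<close>

lemma partial_sum_ge:
  fixes u :: "nat \<Rightarrow> real"
  assumes "\<And>i. 0 \<le> u i" "0 \<le> t"
  shows "t * (1 - of_bool (arrival_time u n \<le> t)) \<le>
         u 0 + (\<Sum>k<n. of_bool (arrival_time u k \<le> t) * u (Suc k))"
proof -
  let ?L = "\<lambda>n. u 0 + (\<Sum>k<n. of_bool (arrival_time u k \<le> t) * u (Suc k))"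
  have "0 \<le> ?L n \<and> (t \<le> ?L n \<or> ?L n = arrival_time u n)"
  proof (induction n)
    case 0
    then show ?case using assms by (auto simp: arrival_time_def)
  next
    case (Suc n)
    have "?L (Suc n) = ?L n + of_bool (arrival_time u n \<le> t) * u (Suc n)"
      by simp
    then show ?case
      using Suc assms(1)[of "Suc n"]
      by (cases "arrival_time u n \<le> t") (auto simp: arrival_time_Suc)
  qed
  then show ?thesis
    by (cases "arrival_time u n \<le> t") auto
qed

context pricing_system
begin

section \<open>Bounds for the interarrival transform\<close>

abbreviation lst :: "nat \<Rightarrow> real" where
  "lst j \<equiv> laplace_stieltjes M (U 0) (real j * \<mu>)"

lemma integrable_exp_U: "integrable M (\<lambda>\<omega>. exp (- (real j * \<mu>) * U i \<omega>))"
proof (rule integrable_const_bound[where B = 1])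
  show "AE \<omega> in M. norm (exp (- (real j * \<mu>) * U i \<omega>)) \<le> 1"
    using AE_U_nonneg by eventually_elim (use service_rate_pos in auto)
qed measurable

lemma lst_pos: "0 < lst j"
proof -
  have "0 \<le> lst j"
    unfolding laplace_stieltjes_def by (rule integral_nonneg_AE) simp
  moreover have "lst j \<noteq> 0"
  proof
    assume "lst j = 0"
    then have "AE \<omega> in M. exp (- (real j * \<mu>) * U 0 \<omega>) = 0"
      unfolding laplace_stieltjes_def
      by (subst (asm) integral_nonneg_eq_0_iff_AE) (use integrable_exp_U in auto)
    then have "AE \<omega> in M. False"
      by simp
    then show False
      using AE_False by simp
  qed
  ultimately show ?thesis by simp
qed

lemma lst_le_1: "lst j \<le> 1"
proof -
  have "lst j \<le> (\<integral>\<omega>. 1 \<partial>M)"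
    unfolding laplace_stieltjes_def
  proof (rule integral_mono_AE)
    show "AE \<omega> in M. exp (- (real j * \<mu>) * U 0 \<omega>) \<le> 1"
      using AE_U_nonneg by eventually_elim (use service_rate_pos in auto)
  qed (use integrable_exp_U in auto)
  then show ?thesis
    by (simp add: prob_space)
qed

text \<open>Bernoulli's inequality for \<open>x = exp (- \<mu> * U 0 \<omega>)\<close> gives
  \<open>1 - x ^ j \<le> j * (1 - x)\<close>. Thus control at \<open>\<mu>\<close> yields control at
  all its multiples.\<close>

lemma one_minus_lst_le: "1 - lst j \<le> real j * (1 - lst 1)"
proof -
  have "(\<integral>\<omega>. 1 - exp (- (real j * \<mu>) * U 0 \<omega>) \<partial>M) \<le>
      (\<integral>\<omega>. real j * (1 - exp (- (real 1 * \<mu>) * U 0 \<omega>)) \<partial>M)"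
  proof (rule integral_mono_AE)
    show "AE \<omega> in M. 1 - exp (- (real j * \<mu>) * U 0 \<omega>) \<le>
        real j * (1 - exp (- (real 1 * \<mu>) * U 0 \<omega>))"
      using AE_U_nonneg
    proof eventually_elim
      case (elim \<omega>)
      define x where "x = exp (- \<mu> * U 0 \<omega>)"
      have "0 \<le> x" "x \<le> 1"
        using elim service_rate_pos by (auto simp: x_def)
      then have "1 + real j * (x - 1) \<le> (1 + (x - 1)) ^ j"
        by (intro Bernoulli_inequality) auto
      also have "(1 + (x - 1)) ^ j = exp (- (real j * \<mu>) * U 0 \<omega>)"
        by (simp add: x_def exp_of_nat_mult[symmetric] algebra_simps)
      finally show ?case
        by (simp add: x_def algebra_simps)
    qed
  qed (use integrable_exp_U[of j 0] integrable_exp_U[of 1 0] in auto)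
  then show ?thesis
    using integrable_exp_U[of j 0] integrable_exp_U[of 1 0]
    by (simp add: laplace_stieltjes_def prob_space)
qed

section \<open>Drift of the binomial moments\<close>

lemma AE_busy_le: "AE \<omega> in M. \<forall>k. busy K p k \<omega> \<le> K"
  using AE_U_nonneg AE_S_pos by eventually_elim (auto intro: card_present_le)

text \<open>The subset identity is summed over all \<open>J\<close> of size \<open>Suc i\<close>. An
  admission changes the binomial coefficient by Pascal's rule, and the valuation test contributes
  its probability as an independent factor.\<close>

lemma expectation_choose_busy_Suc:
  "(\<integral>\<omega>. of_bool (arr k \<omega> \<le> t) * real (busy K p (Suc k) \<omega> choose Suc i) \<partial>M) =
   lst (Suc i) *
     ((\<integral>\<omega>. of_bool (arr k \<omega> \<le> t) * real (busy K p k \<omega> choose Suc i) \<partial>M) +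
      measure G {p..} *
        (\<integral>\<omega>. of_bool (arr k \<omega> \<le> t) * (of_bool (busy K p k \<omega> < K) * real (busy K p k \<omega> choose i)) \<partial>M))"
proof -
  let ?F = "{J. J \<subseteq> {..k} \<and> card J = Suc i}"
  have fin: "finite J" if "J \<in> ?F" for J
    using that finite_subset by auto
  have choose_pres: "of_bool (arr k \<omega> \<le> t) * real (busy K p (Suc k) \<omega> choose Suc i) =
      (\<Sum>J\<in>?F. of_bool (arr k \<omega> \<le> t \<and> J \<subseteq> pres K p (Suc k) \<omega>))" for \<omega>
    unfolding of_bool_conj sum_distrib_left[symmetric]
    by (subst choose_card_eq_sum[where E = "{..k}"]) (auto simp: present_def)
  have choose_after: "of_bool (arr k \<omega> \<le> t) * real (card (pres_after K p k \<omega>) choose Suc i) =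
      (\<Sum>J\<in>?F. of_bool (arr k \<omega> \<le> t \<and> J \<subseteq> pres_after K p k \<omega>))" for \<omega>
    unfolding of_bool_conj sum_distrib_left[symmetric]
    by (subst choose_card_eq_sum[where E = "{..k}"]) (auto simp: present_after_def)
  have int: "integrable M (\<lambda>\<omega>. of_bool (arr k \<omega> \<le> t \<and> J \<subseteq> pres K p (Suc k) \<omega>) :: real)"
    "integrable M (\<lambda>\<omega>. of_bool (arr k \<omega> \<le> t \<and> J \<subseteq> pres_after K p k \<omega>) :: real)" if "J \<in> ?F" for J
  proof -
    note [measurable] = pred_subset_present[OF fin[OF that]] pred_subset_present_after[OF fin[OF that]]
    show "integrable M (\<lambda>\<omega>. of_bool (arr k \<omega> \<le> t \<and> J \<subseteq> pres K p (Suc k) \<omega>) :: real)"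
      by (rule integrable_const_bound[where B = 1]) auto
    show "integrable M (\<lambda>\<omega>. of_bool (arr k \<omega> \<le> t \<and> J \<subseteq> pres_after K p k \<omega>) :: real)"
      by (rule integrable_const_bound[where B = 1]) auto
  qed
  have "(\<integral>\<omega>. of_bool (arr k \<omega> \<le> t) * real (busy K p (Suc k) \<omega> choose Suc i) \<partial>M) =
      (\<integral>\<omega>. (\<Sum>J\<in>?F. of_bool (arr k \<omega> \<le> t \<and> J \<subseteq> pres K p (Suc k) \<omega>)) \<partial>M)"
    unfolding choose_pres ..
  also have "\<dots> = (\<Sum>J\<in>?F. \<integral>\<omega>. of_bool (arr k \<omega> \<le> t \<and> J \<subseteq> pres K p (Suc k) \<omega>) \<partial>M)"
    by (rule Bochner_Integration.integral_sum) (rule int)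
  also have "\<dots> = (\<Sum>J\<in>?F. lst (Suc i) * (\<integral>\<omega>. of_bool (arr k \<omega> \<le> t \<and> J \<subseteq> pres_after K p k \<omega>) \<partial>M))"
    by (intro sum.cong refl) (subst prob_subset_present_Suc, auto)
  also have "\<dots> = lst (Suc i) * (\<integral>\<omega>. (\<Sum>J\<in>?F. of_bool (arr k \<omega> \<le> t \<and> J \<subseteq> pres_after K p k \<omega>)) \<partial>M)"
    using int by (subst Bochner_Integration.integral_sum) (auto simp: sum_distrib_left)
  also have "(\<integral>\<omega>. (\<Sum>J\<in>?F. of_bool (arr k \<omega> \<le> t \<and> J \<subseteq> pres_after K p k \<omega>)) \<partial>M) =
      (\<integral>\<omega>. of_bool (arr k \<omega> \<le> t) * real (card (pres_after K p k \<omega>) choose Suc i) \<partial>M)"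
    unfolding choose_after ..
  also have "\<dots> = (\<integral>\<omega>. of_bool (arr k \<omega> \<le> t) * real (busy K p k \<omega> choose Suc i) +
      of_bool (arr k \<omega> \<le> t \<and> p \<le> V k \<omega>) *
        (of_bool (busy K p k \<omega> < K) * real (busy K p k \<omega> choose i)) \<partial>M)"
  proof (rule integral_cong_AE)
    show "(\<lambda>\<omega>. of_bool (arr k \<omega> \<le> t) * real (card (pres_after K p k \<omega>) choose Suc i))
        \<in> borel_measurable M"
      unfolding choose_after by (intro borel_measurable_sum borel_measurable_integrable int)
    show "(\<lambda>\<omega>. of_bool (arr k \<omega> \<le> t) * real (busy K p k \<omega> choose Suc i) +
      of_bool (arr k \<omega> \<le> t \<and> p \<le> V k \<omega>) *
        (of_bool (busy K p k \<omega> < K) * real (busy K p k \<omega> choose i))) \<in> borel_measurable M"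
      by (intro borel_measurable_add borel_measurable_integrable integrable_of_bool_busy
            [where g = "\<lambda>x. real (x choose Suc i)"]
            integrable_of_bool_busy[where g = "\<lambda>x. of_bool (x < K) * real (x choose i)"]) measurable
    show "AE \<omega> in M. of_bool (arr k \<omega> \<le> t) * real (card (pres_after K p k \<omega>) choose Suc i) =
        of_bool (arr k \<omega> \<le> t) * real (busy K p k \<omega> choose Suc i) +
        of_bool (arr k \<omega> \<le> t \<and> p \<le> V k \<omega>) *
          (of_bool (busy K p k \<omega> < K) * real (busy K p k \<omega> choose i))"
      using AE_S_pos
    proof eventually_elim
      case (elim \<omega>)
      then show ?case
        by (subst card_present_after) (auto simp: admitted_iff of_bool_def)
    qed
  qed
  also have "\<dots> = (\<integral>\<omega>. of_bool (arr k \<omega> \<le> t) * real (busy K p k \<omega> choose Suc i) \<partial>M) +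
      (\<integral>\<omega>. of_bool (arr k \<omega> \<le> t \<and> p \<le> V k \<omega>) *
        (of_bool (busy K p k \<omega> < K) * real (busy K p k \<omega> choose i)) \<partial>M)"
    by (intro Bochner_Integration.integral_add
          integrable_of_bool_busy[where g = "\<lambda>x. real (x choose Suc i)"]
          integrable_of_bool_busy[where g = "\<lambda>x. of_bool (x < K) * real (x choose i)"]) measurable
  finally show ?thesis
    using expectation_valuation_busy[of k t p "\<lambda>x. of_bool (x < K) * real (x choose i)" K] by simp
qed

lemma expectation_poisson_step:
  fixes K p
  defines "q \<equiv> measure G {p..}"
  assumes q: "0 < q"
  shows "(\<integral>\<omega>. of_bool (arr k \<omega> \<le> t) *
             (poisson_sol lst q K (busy K p (Suc k) \<omega>) - poisson_sol lst q K (busy K p k \<omega>)) \<partial>M) =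
         (\<integral>\<omega>. of_bool (arr k \<omega> \<le> t) \<partial>M) -
           takacs_sum lst q K * (\<integral>\<omega>. of_bool (arr k \<omega> \<le> t) * of_bool (busy K p k \<omega> = K) \<partial>M)"
proof -
  let ?c = "\<lambda>i. takacs_weight lst q i / (q * lst (Suc i))"
  let ?a = "\<lambda>\<omega>. of_bool (arr k \<omega> \<le> t) :: real"
  let ?C = "\<lambda>\<omega> i. real (busy K p k \<omega> choose i)"
  have int: "integrable M (\<lambda>\<omega>. ?a \<omega> * g (busy K p l \<omega>))" for l and g :: "nat \<Rightarrow> real"
    by (rule integrable_of_bool_busy) measurable
  note ints = int[of "\<lambda>x. real (x choose i)" for i]
    int[of "\<lambda>x. of_bool (x < K) * real (x choose i)" for i]
  have lin1: "(\<integral>\<omega>. (\<Sum>i<K. c i * X i \<omega> - c i * Y i \<omega>) \<partial>M) =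
      (\<Sum>i<K. c i * (\<integral>\<omega>. X i \<omega> \<partial>M) - c i * (\<integral>\<omega>. Y i \<omega> \<partial>M))"
    if "\<And>i. integrable M (X i)" "\<And>i. integrable M (Y i)" for c and X Y :: "nat \<Rightarrow> 'a \<Rightarrow> real"
    using that by (subst Bochner_Integration.integral_sum) auto
  \<comment> \<open>This direction collects the expectations back under one integral, so that the
    Poisson equation can be applied path by path.\<close>
  have lin2: "(\<Sum>i<K. c i * (l i * ((\<integral>\<omega>. X i \<omega> \<partial>M) + q * (\<integral>\<omega>. Y i \<omega> \<partial>M))) -
        c i * (\<integral>\<omega>. X i \<omega> \<partial>M)) =
      (\<integral>\<omega>. (\<Sum>i<K. c i * (l i * (X i \<omega> + q * Y i \<omega>)) - c i * X i \<omega>) \<partial>M)"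
    if "\<And>i. integrable M (X i)" "\<And>i. integrable M (Y i)" for c l and X Y :: "nat \<Rightarrow> 'a \<Rightarrow> real"
    using that by (subst Bochner_Integration.integral_sum) auto
  have "(\<integral>\<omega>. ?a \<omega> *
      (poisson_sol lst q K (busy K p (Suc k) \<omega>) - poisson_sol lst q K (busy K p k \<omega>)) \<partial>M) =
    (\<integral>\<omega>. (\<Sum>i<K. ?c i * (?a \<omega> * real (busy K p (Suc k) \<omega> choose Suc i)) -
        ?c i * (?a \<omega> * ?C \<omega> (Suc i))) \<partial>M)"
    by (simp add: poisson_sol_def sum_subtractf[symmetric] sum_distrib_left algebra_simps)
  also have "\<dots> = (\<Sum>i<K. ?c i * (\<integral>\<omega>. ?a \<omega> * real (busy K p (Suc k) \<omega> choose Suc i) \<partial>M) -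
      ?c i * (\<integral>\<omega>. ?a \<omega> * ?C \<omega> (Suc i) \<partial>M))"
    by (rule lin1) (rule ints)+
  also have "\<dots> = (\<Sum>i<K. ?c i * (lst (Suc i) *
        ((\<integral>\<omega>. ?a \<omega> * ?C \<omega> (Suc i) \<partial>M) +
          q * (\<integral>\<omega>. ?a \<omega> * (of_bool (busy K p k \<omega> < K) * ?C \<omega> i) \<partial>M))) -
      ?c i * (\<integral>\<omega>. ?a \<omega> * ?C \<omega> (Suc i) \<partial>M))"
    unfolding expectation_choose_busy_Suc q_def ..
  also have "\<dots> = (\<integral>\<omega>. (\<Sum>i<K. ?c i * (lst (Suc i) *
        (?a \<omega> * ?C \<omega> (Suc i) + q * (?a \<omega> * (of_bool (busy K p k \<omega> < K) * ?C \<omega> i)))) -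
      ?c i * (?a \<omega> * ?C \<omega> (Suc i))) \<partial>M)"
    by (rule lin2) (rule ints)+
  also have "\<dots> = (\<integral>\<omega>. ?a \<omega> * (\<Sum>i<K. ?c i * (lst (Suc i) *
        (?C \<omega> (Suc i) + q * (of_bool (busy K p k \<omega> < K) * ?C \<omega> i)) - ?C \<omega> (Suc i))) \<partial>M)"
    by (simp add: sum_distrib_left algebra_simps)
  also have "\<dots> = (\<integral>\<omega>. ?a \<omega> - takacs_sum lst q K * (?a \<omega> * of_bool (busy K p k \<omega> = K)) \<partial>M)"
  proof (rule integral_cong_AE)
    show "(\<lambda>\<omega>. ?a \<omega> * (\<Sum>i<K. ?c i * (lst (Suc i) *
        (?C \<omega> (Suc i) + q * (of_bool (busy K p k \<omega> < K) * ?C \<omega> i)) - ?C \<omega> (Suc i))))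
        \<in> borel_measurable M"
      by (rule borel_measurable_integrable) (rule int)
    show "(\<lambda>\<omega>. ?a \<omega> - takacs_sum lst q K * (?a \<omega> * of_bool (busy K p k \<omega> = K)))
        \<in> borel_measurable M"
      by measurable
    \<comment> \<open>The Poisson equation covers only states up to \<open>K\<close>, and the
      occupancy obeys this bound almost surely.\<close>
    show "AE \<omega> in M. ?a \<omega> * (\<Sum>i<K. ?c i * (lst (Suc i) *
        (?C \<omega> (Suc i) + q * (of_bool (busy K p k \<omega> < K) * ?C \<omega> i)) - ?C \<omega> (Suc i))) =
        ?a \<omega> - takacs_sum lst q K * (?a \<omega> * of_bool (busy K p k \<omega> = K))"
      using AE_busy_le[of K p]
    proof eventually_elim
      case (elim \<omega>)
      have "lst (Suc i) \<noteq> 0" for i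
        using lst_pos[of "Suc i"] by simp
      then show ?case
        using elim q by (subst poisson_equation) (simp_all add: right_diff_distrib mult_ac)
    qed
  qed
  also have "\<dots> = (\<integral>\<omega>. ?a \<omega> \<partial>M) -
      takacs_sum lst q K * (\<integral>\<omega>. ?a \<omega> * of_bool (busy K p k \<omega> = K) \<partial>M)"
    using int[of "\<lambda>_. 1"] int[of "\<lambda>x. of_bool (x = K)" k] by simp
  finally show ?thesis .
qed

text \<open>The bound is uniform in \<open>t\<close> and \<open>n\<close>: along a path the
  increments of \<open>poisson_sol\<close> telescope up to time \<open>t\<close>, and on the states
  up to \<open>K\<close> this function is bounded.\<close>

lemma blocking_defect_bounded:
  fixes K p
  defines "q \<equiv> measure G {p..}"
  assumes q: "0 < q"
  shows "\<exists>H. \<forall>t n. \<bar>(\<Sum>k<n. (\<integral>\<omega>. of_bool (arr k \<omega> \<le> t) \<partial>M)) -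
           takacs_sum lst q K *
             (\<Sum>k<n. (\<integral>\<omega>. of_bool (arr k \<omega> \<le> t) * of_bool (busy K p k \<omega> = K) \<partial>M))\<bar> \<le> H"
proof (intro exI allI)
  fix t n
  let ?h = "poisson_sol lst q K"
  let ?H = "\<Sum>x\<le>K. \<bar>?h x\<bar>"
  let ?d = "\<lambda>k \<omega>. of_bool (arr k \<omega> \<le> t) * (?h (busy K p (Suc k) \<omega>) - ?h (busy K p k \<omega>))"
  have int: "integrable M (?d k)" for k
    unfolding right_diff_distrib
    by (intro Bochner_Integration.integrable_diff integrable_of_bool_busy) measurable
  have "(\<Sum>k<n. (\<integral>\<omega>. of_bool (arr k \<omega> \<le> t) \<partial>M)) -
      takacs_sum lst q K *
        (\<Sum>k<n. (\<integral>\<omega>. of_bool (arr k \<omega> \<le> t) * of_bool (busy K p k \<omega> = K) \<partial>M)) =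
      (\<Sum>k<n. \<integral>\<omega>. ?d k \<omega> \<partial>M)"
    using expectation_poisson_step[of p _ t K] q
    by (simp add: q_def sum_subtractf sum_distrib_left)
  also have "\<dots> = (\<integral>\<omega>. (\<Sum>k<n. ?d k \<omega>) \<partial>M)"
    using int by (subst Bochner_Integration.integral_sum) auto
  finally have eq: "(\<Sum>k<n. (\<integral>\<omega>. of_bool (arr k \<omega> \<le> t) \<partial>M)) -
      takacs_sum lst q K *
        (\<Sum>k<n. (\<integral>\<omega>. of_bool (arr k \<omega> \<le> t) * of_bool (busy K p k \<omega> = K) \<partial>M)) =
      (\<integral>\<omega>. (\<Sum>k<n. ?d k \<omega>) \<partial>M)" .
  have "AE \<omega> in M. norm (\<Sum>k<n. ?d k \<omega>) \<le> 2 * ?H"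
    using AE_busy_le[of K p] AE_U_nonneg
  proof eventually_elim
    case (elim \<omega>)
    have "\<bar>\<Sum>k<n. ?d k \<omega>\<bar> \<le> 2 * ?H"
    proof (rule antimono_telescope_bound)
      show "arr k \<omega> \<le> t" if "arr (Suc k) \<omega> \<le> t" for k
        using that elim(2) arrival_time_mono[of "\<lambda>i. U i \<omega>" k "Suc k"] by auto
      show "\<bar>?h (busy K p k \<omega>)\<bar> \<le> ?H" for k
        using elim(1) by (intro member_le_sum[where f = "\<lambda>x. \<bar>?h x\<bar>"]) auto
    qed
    then show ?case by simp
  qed
  moreover have "integrable M (\<lambda>\<omega>. \<Sum>k<n. ?d k \<omega>)"
    using int by (intro Bochner_Integration.integrable_sum)
  ultimately have "(\<integral>\<omega>. norm (\<Sum>k<n. ?d k \<omega>) \<partial>M) \<le> (\<integral>\<omega>. 2 * ?H \<partial>M)"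
    by (intro integral_mono_AE integrable_norm integrable_const)
  then have "norm (\<integral>\<omega>. (\<Sum>k<n. ?d k \<omega>) \<partial>M) \<le> (\<integral>\<omega>. 2 * ?H \<partial>M)"
    by (rule order_trans[OF integral_norm_bound])
  then show "\<bar>(\<Sum>k<n. (\<integral>\<omega>. of_bool (arr k \<omega> \<le> t) \<partial>M)) -
      takacs_sum lst q K *
        (\<Sum>k<n. (\<integral>\<omega>. of_bool (arr k \<omega> \<le> t) * of_bool (busy K p k \<omega> = K) \<partial>M))\<bar> \<le> 2 * ?H"
    unfolding eq by (simp add: prob_space)
qed

subsection \<open>The elementary renewal theorem\<close>

abbreviation arrival_prob :: "real \<Rightarrow> nat \<Rightarrow> real" where
  "arrival_prob t k \<equiv> (\<integral>\<omega>. of_bool (arr k \<omega> \<le> t) \<partial>M)"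

abbreviation blocking_prob :: "nat \<Rightarrow> real \<Rightarrow> real \<Rightarrow> nat \<Rightarrow> real" where
  "blocking_prob K p t k \<equiv> (\<integral>\<omega>. of_bool (arr k \<omega> \<le> t) * of_bool (busy K p k \<omega> = K) \<partial>M)"

lemma integrable_arrival: "integrable M (\<lambda>\<omega>. of_bool (arr k \<omega> \<le> t) :: real)"
  by (rule integrable_const_bound[where B = 1]) auto

lemma integrable_fun_U:
  fixes f :: "real \<Rightarrow> real"
  assumes [measurable]: "f \<in> borel_measurable borel" and "integrable M (\<lambda>\<omega>. f (U 0 \<omega>))"
  shows "integrable M (\<lambda>\<omega>. f (U i \<omega>))"
    and "(\<integral>\<omega>. f (U i \<omega>) \<partial>M) = (\<integral>\<omega>. f (U 0 \<omega>) \<partial>M)"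
proof -
  have "integrable (distr M borel (U 0)) f"
    using assms by (subst integrable_distr_eq) auto
  then have "integrable (distr M borel (U i)) f"
    unfolding U_ident[of i] .
  then show "integrable M (\<lambda>\<omega>. f (U i \<omega>))"
    by (subst (asm) integrable_distr_eq) auto
  have distr: "(\<integral>\<omega>. f (U i \<omega>) \<partial>M) = (\<integral>x. f x \<partial>distr M borel (U i))" for i
    by (subst integral_distr) auto
  show "(\<integral>\<omega>. f (U i \<omega>) \<partial>M) = (\<integral>\<omega>. f (U 0 \<omega>) \<partial>M)"
    unfolding distr U_ident[of i] ..
qed

text \<open>Whether job \<open>k\<close> arrives by time \<open>t\<close> depends only on gaps up to
  index \<open>k\<close>, so the next gap is independent of it.\<close>

lemma wald_step:
  fixes f :: "real \<Rightarrow> real"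
  assumes [measurable]: "f \<in> borel_measurable borel" and int: "integrable M (\<lambda>\<omega>. f (U 0 \<omega>))"
  shows "integrable M (\<lambda>\<omega>. of_bool (arr k \<omega> \<le> t) * f (U (Suc k) \<omega>))"
    and "(\<integral>\<omega>. of_bool (arr k \<omega> \<le> t) * f (U (Suc k) \<omega>) \<partial>M) =
         arrival_prob t k * (\<integral>\<omega>. f (U 0 \<omega>) \<partial>M)"
proof -
  let ?i = "Inl (Suc k) :: nat + nat + nat"
  define g :: "(nat + nat + nat \<Rightarrow> real) \<Rightarrow> real" where
    "g = (\<lambda>y. of_bool (arrival_time (\<lambda>i. y (Inl i)) k \<le> t))"
  have "(\<lambda>y. y (Inl i)) \<in> borel_measurable (PiM (- {?i}) (\<lambda>_. borel :: real measure))" for i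
    by (rule borel_measurable_PiM_component)
  note [measurable] = this
  have g_meas: "g \<in> borel_measurable (PiM (- {?i}) (\<lambda>_. borel))"
    unfolding g_def by measurable
  have g: "g (restrict (\<lambda>j. Z j \<omega>) (- {?i})) = of_bool (arr k \<omega> \<le> t)" for \<omega>
  proof -
    have "arrival_time (\<lambda>i. restrict (\<lambda>j. Z j \<omega>) (- {?i}) (Inl i)) k = arr k \<omega>"
      unfolding arrival_time_def by (rule sum.cong) auto
    then show ?thesis
      by (simp add: g_def)
  qed
  have f_int: "integrable M (\<lambda>\<omega>. f (Z ?i \<omega>))"
    using integrable_fun_U(1)[OF assms] by simp
  have "(\<integral>\<omega>. f (Z ?i \<omega>) * g (restrict (\<lambda>j. Z j \<omega>) (- {?i})) \<partial>M) =
      (\<integral>\<omega>. f (Z ?i \<omega>) \<partial>M) * (\<integral>\<omega>. g (restrict (\<lambda>j. Z j \<omega>) (- {?i})) \<partial>M)"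
  proof (rule expectation_coordinate_mult)
    show "integrable M (\<lambda>\<omega>. g (restrict (\<lambda>j. Z j \<omega>) (- {?i})))"
      unfolding g by (rule integrable_arrival)
  qed (use f_int g_meas in auto)
  then show "(\<integral>\<omega>. of_bool (arr k \<omega> \<le> t) * f (U (Suc k) \<omega>) \<partial>M) =
      arrival_prob t k * (\<integral>\<omega>. f (U 0 \<omega>) \<partial>M)"
    unfolding g using integrable_fun_U(2)[OF assms, of "Suc k"] by (simp add: mult.commute)
  show "integrable M (\<lambda>\<omega>. of_bool (arr k \<omega> \<le> t) * f (U (Suc k) \<omega>))"
    by (rule Bochner_Integration.integrable_bound[OF integrable_fun_U(1)[OF assms, of "Suc k"]]) auto
qed

text \<open>Wald's identity for one plus the number of arrivals up to \<open>t\<close>, cut at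
  \<open>n + 1\<close> terms. A general \<open>f\<close> covers both plain and truncated
  gaps.\<close>

lemma wald:
  fixes f :: "real \<Rightarrow> real"
  assumes [measurable]: "f \<in> borel_measurable borel" and int: "integrable M (\<lambda>\<omega>. f (U 0 \<omega>))"
  shows "integrable M (\<lambda>\<omega>. f (U 0 \<omega>) + (\<Sum>k<n. of_bool (arr k \<omega> \<le> t) * f (U (Suc k) \<omega>)))"
    and "(\<integral>\<omega>. f (U 0 \<omega>) + (\<Sum>k<n. of_bool (arr k \<omega> \<le> t) * f (U (Suc k) \<omega>)) \<partial>M) =
         (1 + (\<Sum>k<n. arrival_prob t k)) * (\<integral>\<omega>. f (U 0 \<omega>) \<partial>M)"
proof -
  note ws = wald_step[OF assms]
  have sum_int: "integrable M (\<lambda>\<omega>. \<Sum>k<n. of_bool (arr k \<omega> \<le> t) * f (U (Suc k) \<omega>))"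
    by (intro Bochner_Integration.integrable_sum ws(1))
  show "integrable M (\<lambda>\<omega>. f (U 0 \<omega>) + (\<Sum>k<n. of_bool (arr k \<omega> \<le> t) * f (U (Suc k) \<omega>)))"
    by (intro Bochner_Integration.integrable_add int sum_int)
  have "(\<integral>\<omega>. f (U 0 \<omega>) + (\<Sum>k<n. of_bool (arr k \<omega> \<le> t) * f (U (Suc k) \<omega>)) \<partial>M) =
      (\<integral>\<omega>. f (U 0 \<omega>) \<partial>M) + (\<Sum>k<n. \<integral>\<omega>. of_bool (arr k \<omega> \<le> t) * f (U (Suc k) \<omega>) \<partial>M)"
    unfolding Bochner_Integration.integral_add[OF int sum_int]
    by (subst Bochner_Integration.integral_sum) (rule ws(1), rule refl)
  then show "(\<integral>\<omega>. f (U 0 \<omega>) + (\<Sum>k<n. of_bool (arr k \<omega> \<le> t) * f (U (Suc k) \<omega>)) \<partial>M) =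
         (1 + (\<Sum>k<n. arrival_prob t k)) * (\<integral>\<omega>. f (U 0 \<omega>) \<partial>M)"
    unfolding ws(2) sum_distrib_right[symmetric] by (simp add: distrib_right)
qed

abbreviation truncated_mean :: "real \<Rightarrow> real" where
  "truncated_mean c \<equiv> (\<integral>\<omega>. min (U 0 \<omega>) c \<partial>M)"

lemma integrable_truncated: "integrable M (\<lambda>\<omega>. min (U 0 \<omega>) c)"
  by (rule Bochner_Integration.integrable_min) (use U_integrable in auto)

lemma partial_renewal_upper:
  assumes "0 \<le> t"
  shows "(1 + (\<Sum>k<n. arrival_prob t k)) * truncated_mean c \<le> t + c"
proof -
  have min_meas: "(\<lambda>x. min x c) \<in> borel_measurable borel"
    by measurable
  note w = wald[OF min_meas integrable_truncated, where n = n and t = t]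
  have "(1 + (\<Sum>k<n. arrival_prob t k)) * truncated_mean c \<le> (\<integral>\<omega>. t + c \<partial>M)"
    unfolding w(2)[symmetric]
  proof (rule integral_mono_AE[OF w(1)])
    show "AE \<omega> in M. min (U 0 \<omega>) c +
        (\<Sum>k<n. of_bool (arr k \<omega> \<le> t) * min (U (Suc k) \<omega>) c) \<le> t + c"
      using AE_U_nonneg by eventually_elim (rule truncated_partial_sum_le, use assms in auto)
  qed simp
  then show ?thesis
    by (simp add: prob_space)
qed

lemma partial_renewal_lower:
  assumes "0 \<le> t"
  shows "t * (1 - arrival_prob t n) \<le> (1 + (\<Sum>k<n. arrival_prob t k)) / arrival_rate"
proof -
  note w = wald[where f = "\<lambda>x. x" and n = n and t = t, OF _ U_integrable]
  have "(\<integral>\<omega>. t * (1 - of_bool (arr n \<omega> \<le> t)) \<partial>M) \<le>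
      (\<integral>\<omega>. U 0 \<omega> + (\<Sum>k<n. of_bool (arr k \<omega> \<le> t) * U (Suc k) \<omega>) \<partial>M)"
  proof (rule integral_mono_AE)
    show "AE \<omega> in M. t * (1 - of_bool (arr n \<omega> \<le> t)) \<le>
        U 0 \<omega> + (\<Sum>k<n. of_bool (arr k \<omega> \<le> t) * U (Suc k) \<omega>)"
      using AE_U_nonneg by eventually_elim (rule partial_sum_ge, use assms in auto)
  qed (use w(1) integrable_arrival in auto)
  then show ?thesis
    using integrable_arrival[of n t] w(2) by (simp add: prob_space U_mean)
qed

lemma truncated_mean_tendsto: "(\<lambda>n. truncated_mean (real n)) \<longlonglongrightarrow> 1 / arrival_rate"
proof -
  have "(\<lambda>n. truncated_mean (real n)) \<longlonglongrightarrow> (\<integral>\<omega>. U 0 \<omega> \<partial>M)"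
  proof (rule integral_dominated_convergence[where w = "U 0"])
    show "AE \<omega> in M. (\<lambda>n. min (U 0 \<omega>) (real n)) \<longlonglongrightarrow> U 0 \<omega>"
    proof (rule AE_I2)
      fix \<omega>
      obtain N :: nat where "U 0 \<omega> \<le> real N"
        using real_arch_simple by blast
      then have "\<forall>\<^sub>F n in sequentially. min (U 0 \<omega>) (real n) = U 0 \<omega>"
        by (intro eventually_sequentiallyI[of N]) auto
      then show "(\<lambda>n. min (U 0 \<omega>) (real n)) \<longlonglongrightarrow> U 0 \<omega>"
        by (rule tendsto_eventually)
    qed
    show "AE \<omega> in M. norm (min (U 0 \<omega>) (real n)) \<le> U 0 \<omega>" for n
      using AE_U_nonneg by eventually_elim (auto simp: min_def)
  qed (use U_integrable in auto)
  then show ?thesis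
    by (simp add: U_mean)
qed

lemma arrival_prob_nonneg: "0 \<le> arrival_prob t k"
  by (rule integral_nonneg_AE) simp

text \<open>The renewal upper bound is uniform in \<open>n\<close>, and it bounds the partial sums
  once the truncated mean is positive; this holds for large \<open>c\<close> because the gaps have
  positive mean.\<close>

lemma summable_arrival_prob:
  assumes "0 \<le> t"
  shows "summable (arrival_prob t)"
proof -
  have "\<forall>\<^sub>F n in sequentially. 0 < truncated_mean (real n)"
    by (rule order_tendstoD(1)[OF truncated_mean_tendsto]) (use arrival_rate_pos in simp)
  then obtain c :: nat where c: "0 < truncated_mean (real c)"
    by (auto simp: eventually_sequentially)
  show ?thesis
  proof (rule bounded_imp_summable)
    fix n
    have "(\<Sum>k<Suc n. arrival_prob t k) \<le> (t + real c) / truncated_mean (real c) - 1"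
      using partial_renewal_upper[OF assms, of "Suc n" "real c"] c by (simp add: field_simps)
    then show "(\<Sum>k\<le>n. arrival_prob t k) \<le> (t + real c) / truncated_mean (real c) - 1"
      by (simp add: lessThan_Suc_atMost)
  qed (rule arrival_prob_nonneg)
qed

lemma renewal_upper:
  assumes "0 \<le> t"
  shows "(1 + suminf (arrival_prob t)) * truncated_mean c \<le> t + c"
proof (rule LIMSEQ_le_const2)
  show "(\<lambda>n. (1 + (\<Sum>k<n. arrival_prob t k)) * truncated_mean c)
      \<longlonglongrightarrow> (1 + suminf (arrival_prob t)) * truncated_mean c"
    by (intro tendsto_intros summable_LIMSEQ summable_arrival_prob assms)
qed (use partial_renewal_upper assms in blast)

lemma renewal_lower:
  assumes "0 \<le> t"
  shows "t \<le> (1 + suminf (arrival_prob t)) / arrival_rate"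
proof (rule LIMSEQ_le)
  show "(\<lambda>n. (1 + (\<Sum>k<n. arrival_prob t k)) / arrival_rate)
      \<longlonglongrightarrow> (1 + suminf (arrival_prob t)) / arrival_rate"
    using arrival_rate_pos
    by (intro tendsto_intros summable_LIMSEQ summable_arrival_prob assms) auto
  \<comment> \<open>The correction vanishes because the arrival probabilities are the terms of a
    convergent series.\<close>
  have "(\<lambda>n. t * (1 - arrival_prob t n)) \<longlonglongrightarrow> t * (1 - 0)"
    by (intro tendsto_intros summable_LIMSEQ_zero summable_arrival_prob assms)
  then show "(\<lambda>n. t * (1 - arrival_prob t n)) \<longlonglongrightarrow> t"
    by simp
qed (use partial_renewal_lower assms in blast)

text \<open>The lower estimate uses plain gaps, whose overshoot past \<open>t\<close> only helps,
  and has error \<open>1 / t\<close>. The upper one uses gaps truncated at a level depending on the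
  target \<open>y\<close>.\<close>

lemma elementary_renewal: "((\<lambda>t. suminf (arrival_prob t) / t) \<longlongrightarrow> arrival_rate) at_top"
proof (rule order_tendstoI)
  fix y assume "y < arrival_rate"
  have "((\<lambda>t. arrival_rate - 1 / t) \<longlongrightarrow> arrival_rate - 0) at_top"
    by (intro tendsto_intros tendsto_divide_0[OF tendsto_const] filterlim_at_top_imp_at_infinity filterlim_ident)
  then have "\<forall>\<^sub>F t in at_top. y < arrival_rate - 1 / t"
    using \<open>y < arrival_rate\<close> by (intro order_tendstoD(1)) auto
  then show "\<forall>\<^sub>F t in at_top. y < suminf (arrival_prob t) / t"
    using eventually_gt_at_top[of 0]
  proof eventually_elim
    case (elim t)
    have "arrival_rate * t - 1 \<le> suminf (arrival_prob t)"
      using renewal_lower[of t] elim arrival_rate_pos by (simp add: field_simps)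
    then have "(arrival_rate * t - 1) / t \<le> suminf (arrival_prob t) / t"
      using elim by (intro divide_right_mono) auto
    then show ?case
      using elim by (simp add: diff_divide_distrib)
  qed
next
  fix y assume y: "arrival_rate < y"
  have "1 / y < 1 / arrival_rate"
    using y arrival_rate_pos by (simp add: frac_less2)
  \<comment> \<open>The level is taken so large that the limiting bound
    \<open>1 / truncated_mean\<close> falls below \<open>y\<close>.\<close>
  then have "\<forall>\<^sub>F n in sequentially. 1 / y < truncated_mean (real n)"
    by (intro order_tendstoD(1)[OF truncated_mean_tendsto])
  then obtain c :: nat where c: "1 / y < truncated_mean (real c)"
    by (auto simp: eventually_sequentially)
  have "0 < y" using y arrival_rate_pos by simp
  then have e: "0 < truncated_mean (real c)"
    using c by (meson divide_pos_pos less_trans zero_less_one)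
  have "((\<lambda>t. (1 + real c / t) / truncated_mean (real c)) \<longlongrightarrow> (1 + 0) / truncated_mean (real c)) at_top"
    using e by (intro tendsto_intros tendsto_divide_0[OF tendsto_const] filterlim_at_top_imp_at_infinity
      filterlim_ident) auto
  moreover have "(1 + 0) / truncated_mean (real c) < y"
    using c e \<open>0 < y\<close> by (simp add: field_simps)
  ultimately have "\<forall>\<^sub>F t in at_top. (1 + real c / t) / truncated_mean (real c) < y"
    by (rule order_tendstoD(2))
  then show "\<forall>\<^sub>F t in at_top. suminf (arrival_prob t) / t < y"
    using eventually_gt_at_top[of 0]
  proof eventually_elim
    case (elim t)
    have "suminf (arrival_prob t) \<le> (t + real c) / truncated_mean (real c)"
      using renewal_upper[of t "real c"] elim e by (simp add: field_simps)
    then have "suminf (arrival_prob t) / t \<le> (t + real c) / truncated_mean (real c) / t"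
      using elim by (intro divide_right_mono) auto
    also have "\<dots> = (1 + real c / t) / truncated_mean (real c)"
      using elim by (simp add: field_simps)
    finally show ?case
      using elim by simp
  qed
qed

end

subsection \<open>The revenue rate\<close>

lemma takacs_sum_eq:
  "takacs_sum f q K = 1 + (\<Sum>i<K. takacs_weight f q (Suc i) * real (K choose Suc i))"
  by (simp add: takacs_sum_def sum.atMost_shift takacs_weight_def[of f q 0])

context pricing_system
begin

text \<open>All weights are nonnegative since the transforms lie between 0 (excluded) and 1, and the
  index 0 term is 1.\<close>

lemma takacs_sum_ge_1:
  assumes "0 < q"
  shows "1 \<le> takacs_sum lst q K"
proof -
  have "0 \<le> takacs_weight lst q i" for i
    unfolding takacs_weight_def
  proof (rule prod_nonneg)
    fix j
    show "0 \<le> (1 - lst (Suc j)) / (q * lst (Suc j))"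
      using lst_pos[of "Suc j"] lst_le_1[of "Suc j"] assms by (intro divide_nonneg_pos mult_pos_pos) linarith+
  qed
  then show ?thesis
    unfolding takacs_sum_eq by (simp add: sum_nonneg)
qed

lemma blocking_prob_nonneg: "0 \<le> blocking_prob K p t k"
  by (rule integral_nonneg_AE) simp

lemma integrable_blocking:
  "integrable M (\<lambda>\<omega>. of_bool (arr k \<omega> \<le> t) * of_bool (busy K p k \<omega> = K) :: real)"
  by (rule integrable_of_bool_busy[where g = "\<lambda>x. of_bool (x = K)"]) measurable

lemma summable_blocking_prob:
  assumes "0 \<le> t"
  shows "summable (blocking_prob K p t)"
proof (rule summable_comparison_test'[OF summable_arrival_prob[OF assms]])
  fix k
  have "blocking_prob K p t k \<le> arrival_prob t k"
    by (rule integral_mono[OF integrable_blocking integrable_arrival]) simp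
  then show "norm (blocking_prob K p t k) \<le> arrival_prob t k"
    using blocking_prob_nonneg by simp
qed

text \<open>After exchanging expectation and series, each term splits off the acceptance
  probability; almost surely a state that is not below \<open>K\<close> equals
  \<open>K\<close>.\<close>

lemma expected_revenue_eq:
  assumes "0 \<le> t" "0 \<le> p"
  shows "expected_revenue M U S V K p t =
         p * measure G {p..} * (suminf (arrival_prob t) - suminf (blocking_prob K p t))"
proof -
  let ?F = "\<lambda>k \<omega>. if arr k \<omega> \<le> t \<and> adm K p k \<omega> then p else 0"
  have F_int: "integrable M (?F k)" for k
  proof (rule integrable_const_bound[where B = p])
    show "?F k \<in> borel_measurable M"
      by measurable
  qed (use assms in auto)
  have F_integral: "(\<integral>\<omega>. ?F k \<omega> \<partial>M) =
      p * measure G {p..} * (arrival_prob t k - blocking_prob K p t k)" for k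
  proof -
    have "(\<integral>\<omega>. ?F k \<omega> \<partial>M) =
        (\<integral>\<omega>. p * (of_bool (arr k \<omega> \<le> t \<and> p \<le> V k \<omega>) * of_bool (busy K p k \<omega> < K)) \<partial>M)"
      by (intro Bochner_Integration.integral_cong refl) (auto simp: admitted_iff)
    also have "\<dots> = p * (measure G {p..} *
        (\<integral>\<omega>. of_bool (arr k \<omega> \<le> t) * of_bool (busy K p k \<omega> < K) \<partial>M))"
      using expectation_valuation_busy[of k t p "\<lambda>x. of_bool (x < K)" K] by simp
    also have "(\<integral>\<omega>. (of_bool (arr k \<omega> \<le> t) * of_bool (busy K p k \<omega> < K) :: real) \<partial>M) =
        (\<integral>\<omega>. of_bool (arr k \<omega> \<le> t) - of_bool (arr k \<omega> \<le> t) * of_bool (busy K p k \<omega> = K) \<partial>M)"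
    proof (rule integral_cong_AE)
      show "AE \<omega> in M. (of_bool (arr k \<omega> \<le> t) * of_bool (busy K p k \<omega> < K) :: real) =
          of_bool (arr k \<omega> \<le> t) - of_bool (arr k \<omega> \<le> t) * of_bool (busy K p k \<omega> = K)"
        using AE_busy_le[of K p]
      proof eventually_elim
        case (elim \<omega>)
        then have "busy K p k \<omega> \<le> K" by blast
        then show ?case by (auto simp: le_less)
      qed
    qed measurable
    also have "\<dots> = arrival_prob t k - blocking_prob K p t k"
      by (rule Bochner_Integration.integral_diff[OF integrable_arrival integrable_blocking])
    finally show ?thesis by simp
  qed
  have "arrival_prob t k = prob {\<omega> \<in> space M. arr k \<omega> \<le> t}" for k
  proof -
    have "arrival_prob t k = (\<integral>\<omega>. indicator {\<omega> \<in> space M. arr k \<omega> \<le> t} \<omega> \<partial>M)"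
      by (intro Bochner_Integration.integral_cong refl) (auto simp: indicator_def)
    then show ?thesis
      by (simp add: Int_absorb1 Int_absorb2 subset_iff)
  qed
  then have "summable (\<lambda>k. prob {\<omega> \<in> space M. arr k \<omega> \<le> t})"
    using summable_arrival_prob[OF assms(1)] by simp
  \<comment> \<open>By Borel-Cantelli almost surely only finitely many jobs arrive by
    \<open>t\<close>, which gives the pathwise summability required for the exchange.\<close>
  then have "AE \<omega> in M. \<forall>\<^sub>F k in sequentially. \<omega> \<in> space M - {\<omega> \<in> space M. arr k \<omega> \<le> t}"
    by (intro borel_cantelli_AE1) (auto simp: emeasure_eq_measure)
  then have F_summable: "AE \<omega> in M. summable (\<lambda>k. norm (?F k \<omega>))"
  proof eventually_elim
    case (elim \<omega>)
    then have "\<forall>\<^sub>F k in sequentially. norm (?F k \<omega>) = 0"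
      by eventually_elim auto
    from summable_cong[OF this] show ?case by simp
  qed
  have "(\<lambda>k. \<integral>\<omega>. norm (?F k \<omega>) \<partial>M) = (\<lambda>k. \<integral>\<omega>. ?F k \<omega> \<partial>M)"
    using assms(2) by (intro ext Bochner_Integration.integral_cong) auto
  moreover have "summable (\<lambda>k. \<integral>\<omega>. ?F k \<omega> \<partial>M)"
    unfolding F_integral
    by (intro summable_mult summable_diff summable_arrival_prob summable_blocking_prob assms)
  ultimately have F_summable': "summable (\<lambda>k. \<integral>\<omega>. norm (?F k \<omega>) \<partial>M)"
    by simp
  have "expected_revenue M U S V K p t = (\<Sum>k. \<integral>\<omega>. ?F k \<omega> \<partial>M)"
    unfolding expected_revenue_def revenue_def
    by (rule integral_suminf[OF F_int F_summable F_summable'])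
  also have "\<dots> = p * measure G {p..} * (suminf (arrival_prob t) - suminf (blocking_prob K p t))"
    unfolding F_integral
    by (subst suminf_mult)
       (auto intro!: summable_diff summable_arrival_prob summable_blocking_prob assms
         simp: suminf_diff[symmetric] summable_arrival_prob summable_blocking_prob assms)
  finally show ?thesis .
qed

text \<open>The defect between arrivals and \<open>takacs_sum\<close> times blocked arrivals is
  bounded, so it vanishes after division by \<open>t\<close>; the elementary renewal theorem
  supplies the rest.\<close>

lemma revenue_rate_tendsto:
  fixes K p
  defines "q \<equiv> measure G {p..}"
  assumes "0 \<le> p" "0 < q"
  shows "((\<lambda>t. expected_revenue M U S V K p t / t) \<longlongrightarrow>
           p * q * (arrival_rate * (1 - 1 / takacs_sum lst q K))) at_top"
proof -
  let ?D = "takacs_sum lst q K"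
  let ?m = "\<lambda>t. suminf (arrival_prob t)"
  let ?b = "\<lambda>t. suminf (blocking_prob K p t)"
  have D: "0 < ?D"
    using takacs_sum_ge_1[OF assms(3), of K] by simp
  obtain H where H: "\<bar>(\<Sum>k<n. arrival_prob t k) - ?D * (\<Sum>k<n. blocking_prob K p t k)\<bar> \<le> H" for t n
    using blocking_defect_bounded[of p K] assms(3) unfolding q_def by auto
  have bound: "\<bar>?m t - ?D * ?b t\<bar> \<le> H" if "0 \<le> t" for t
  proof (rule LIMSEQ_le_const2)
    show "(\<lambda>n. \<bar>(\<Sum>k<n. arrival_prob t k) - ?D * (\<Sum>k<n. blocking_prob K p t k)\<bar>)
        \<longlonglongrightarrow> \<bar>?m t - ?D * ?b t\<bar>"
      by (intro tendsto_intros summable_LIMSEQ summable_arrival_prob summable_blocking_prob that)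
  qed (use H in blast)
  have "\<forall>\<^sub>F t in at_top. norm ((?m t - ?D * ?b t) / t) \<le> H / t"
    using eventually_gt_at_top[of 0]
  proof eventually_elim
    case (elim t)
    then show ?case
      using bound[of t] by (simp add: abs_divide divide_right_mono)
  qed
  moreover have "((\<lambda>t. H / t) \<longlongrightarrow> 0) at_top"
    by (intro tendsto_divide_0[OF tendsto_const] filterlim_at_top_imp_at_infinity filterlim_ident)
  ultimately have "((\<lambda>t. (?m t - ?D * ?b t) / t) \<longlongrightarrow> 0) at_top"
    by (rule Lim_null_comparison)
  \<comment> \<open>The blocked count is written as \<open>(?m t - (?m t - ?D * ?b t)) / ?D\<close>,
    which isolates the two quantities with known limits.\<close>
  then have "((\<lambda>t. p * q * (?m t / t - (?m t / t - (?m t - ?D * ?b t) / t) / ?D)) \<longlongrightarrow>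
      p * q * (arrival_rate - (arrival_rate - 0) / ?D)) at_top"
    using D by (intro tendsto_intros elementary_renewal) auto
  moreover have "\<forall>\<^sub>F t in at_top. p * q * (?m t / t - (?m t / t - (?m t - ?D * ?b t) / t) / ?D) =
      expected_revenue M U S V K p t / t"
    using eventually_gt_at_top[of 0]
  proof eventually_elim
    case (elim t)
    then show ?case
      using D assms(2) by (simp add: expected_revenue_eq q_def field_simps)
  qed
  ultimately have "((\<lambda>t. expected_revenue M U S V K p t / t) \<longlongrightarrow>
      p * q * (arrival_rate - (arrival_rate - 0) / ?D)) at_top"
    by (rule Lim_transform_eventually)
  then show ?thesis
    by (simp add: right_diff_distrib)
qed

lemma mean_revenue_rate_eq:
  assumes "0 \<le> p" "0 < measure G {p..}"
  shows "mean_revenue_rate M U S V K p =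
    p * measure G {p..} * (arrival_rate * (1 - 1 / takacs_sum lst (measure G {p..}) K))"
  unfolding mean_revenue_rate_def
  by (rule tendsto_Lim[OF _ revenue_rate_tendsto[OF assms]]) simp

end

section \<open>Limit of large arrival rates\<close>

lemma takacs_sum_tendsto:
  fixes f :: "real \<Rightarrow> nat \<Rightarrow> real"
  assumes f: "\<And>j. ((\<lambda>l. f l (Suc j)) \<longlongrightarrow> 1) at_top"
    and f1: "((\<lambda>l. l * (1 - f l 1)) \<longlongrightarrow> m) at_top"
    and q: "q \<noteq> 0"
  shows "((\<lambda>l. l * (1 - 1 / takacs_sum (f l) q K)) \<longlongrightarrow> m / q * real K) at_top"
proof -
  let ?D = "\<lambda>l. takacs_sum (f l) q K"
  \<comment> \<open>The factor \<open>l\<close> is absorbed by the first factor of the weight; every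
    further factor tends to 0, which produces \<open>0 ^ i\<close>.\<close>
  have "((\<lambda>l. l * (1 - f l 1) / (q * f l 1) *
      (\<Prod>j<i. (1 - f l (Suc (Suc j))) / (q * f l (Suc (Suc j))))) \<longlongrightarrow>
      m / (q * 1) * (\<Prod>j<i. (1 - 1) / (q * 1))) at_top" for i
    using q f[of 0] by (intro tendsto_intros f f1) auto
  moreover have "takacs_weight (f l) q (Suc i) = (1 - f l 1) / (q * f l 1) *
      (\<Prod>j<i. (1 - f l (Suc (Suc j))) / (q * f l (Suc (Suc j))))" for l i
    by (simp add: takacs_weight_def prod.lessThan_Suc_shift del: prod.lessThan_Suc)
  ultimately have w: "((\<lambda>l. l * takacs_weight (f l) q (Suc i)) \<longlongrightarrow> m / q * 0 ^ i) at_top" for i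
    by (simp add: mult.assoc)
  have "((\<lambda>l. \<Sum>i<K. l * takacs_weight (f l) q (Suc i) * real (K choose Suc i)) \<longlongrightarrow>
      (\<Sum>i<K. m / q * 0 ^ i * real (K choose Suc i))) at_top"
    by (intro tendsto_intros w)
  \<comment> \<open>Only \<open>i = 0\<close> survives, with \<open>K choose 1 = K\<close>; the case
    split covers the empty sum for \<open>K = 0\<close>.\<close>
  moreover have "(\<Sum>i<K. m / q * 0 ^ i * real (K choose Suc i)) = m / q * real K"
    by (cases K) (simp_all add: sum.lessThan_Suc_shift del: sum.lessThan_Suc)
  moreover have "(\<Sum>i<K. l * takacs_weight (f l) q (Suc i) * real (K choose Suc i)) = l * (?D l - 1)" for l
    by (simp add: takacs_sum_eq sum_distrib_left mult.assoc)
  ultimately have num: "((\<lambda>l. l * (?D l - 1)) \<longlongrightarrow> m / q * real K) at_top"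
    by simp
  \<comment> \<open>Convergence of \<open>l * (?D l - 1)\<close> forces \<open>?D l\<close> to tend
    to 1.\<close>
  have "((\<lambda>l. l * (?D l - 1) / l + 1) \<longlongrightarrow> 0 + 1) at_top"
    by (intro tendsto_add tendsto_const tendsto_divide_0[OF num] filterlim_at_top_imp_at_infinity
      filterlim_ident)
  moreover have "\<forall>\<^sub>F l in at_top. l * (?D l - 1) / l + 1 = ?D l"
    using eventually_gt_at_top[of 0] by eventually_elim simp
  ultimately have D: "(?D \<longlongrightarrow> 1) at_top"
    using Lim_transform_eventually by fastforce
  have "((\<lambda>l. l * (?D l - 1) / ?D l) \<longlongrightarrow> m / q * real K / 1) at_top"
    by (intro tendsto_divide num D) simp
  moreover have "\<forall>\<^sub>F l in at_top. l * (?D l - 1) / ?D l = l * (1 - 1 / ?D l)"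
    using order_tendstoD(1)[OF D zero_less_one] by eventually_elim (simp add: field_simps)
  ultimately show ?thesis
    using Lim_transform_eventually by fastforce
qed

theorem theorem15:
  fixes M :: "real \<Rightarrow> 'a measure"
    and U S V :: "real \<Rightarrow> nat \<Rightarrow> 'a \<Rightarrow> real"
    and G :: "real measure"
    and K :: nat
    and \<mu> \<mu>' p :: real
  assumes "\<And>l. 0 < l \<Longrightarrow> pricing_system (M l) G (U l) (S l) (V l) l \<mu>"
    and "((\<lambda>l. l * (1 - laplace_stieltjes (M l) (U l 0) \<mu>)) \<longlongrightarrow> \<mu>') at_top"
    and "0 \<le> p"
    and "0 < measure G {p..}"
  shows "(\<forall>l>0. ((\<lambda>t. expected_revenue (M l) (U l) (S l) (V l) K p t / t)
                    \<longlongrightarrow> mean_revenue_rate (M l) (U l) (S l) (V l) K p) at_top)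
       \<and> Bfun (\<lambda>l. mean_revenue_rate (M l) (U l) (S l) (V l) K p) at_top
       \<and> ((\<lambda>l. mean_revenue_rate (M l) (U l) (S l) (V l) K p) \<longlongrightarrow> \<mu>' * p * real K) at_top"
proof -
  let ?q = "measure G {p..}"
  let ?R = "\<lambda>l. mean_revenue_rate (M l) (U l) (S l) (V l) K p"
  define f where "f = (\<lambda>l j. laplace_stieltjes (M l) (U l 0) (real j * \<mu>))"
  \<comment> \<open>\<open>mean_revenue_rate\<close> is defined through \<open>Lim\<close>, which is
    meaningful only when the limit exists; \<open>rate\<close> records that it does.\<close>
  have rate: "((\<lambda>t. expected_revenue (M l) (U l) (S l) (V l) K p t / t) \<longlongrightarrow> ?R l) at_top"
    and R: "?R l = p * ?q * (l * (1 - 1 / takacs_sum (f l) ?q K))" if "0 < l" for l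
  proof -
    interpret pricing_system "M l" G "U l" "S l" "V l" l \<mu>
      by (rule assms(1)[OF that])
    show "?R l = p * ?q * (l * (1 - 1 / takacs_sum (f l) ?q K))"
      unfolding f_def by (rule mean_revenue_rate_eq[OF assms(3,4)])
    show "((\<lambda>t. expected_revenue (M l) (U l) (S l) (V l) K p t / t) \<longlongrightarrow> ?R l) at_top"
      unfolding mean_revenue_rate_eq[OF assms(3,4)] by (rule revenue_rate_tendsto[OF assms(3,4)])
  qed
  have f1: "((\<lambda>l. l * (1 - f l 1)) \<longlongrightarrow> \<mu>') at_top"
    using assms(2) by (simp add: f_def)
  \<comment> \<open>Since \<open>l * (1 - f l 1)\<close> converges, \<open>1 - f l 1\<close> tends
    to 0; the Bernoulli bound carries this over to every multiple of \<open>\<mu>\<close>.\<close>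
  have "((\<lambda>l. l * (1 - f l 1) / l) \<longlongrightarrow> 0) at_top"
    by (intro tendsto_divide_0[OF f1] filterlim_at_top_imp_at_infinity filterlim_ident)
  then have f1_0: "((\<lambda>l. real j * (l * (1 - f l 1) / l)) \<longlongrightarrow> 0) at_top" for j
    by (rule tendsto_mult_right_zero)
  have "((\<lambda>l. 1 - f l j) \<longlongrightarrow> 0) at_top" for j
  proof (rule Lim_null_comparison[OF _ f1_0[of j]])
    show "\<forall>\<^sub>F l in at_top. norm (1 - f l j) \<le> real j * (l * (1 - f l 1) / l)"
      using eventually_gt_at_top[of 0]
    proof eventually_elim
      case (elim l)
      interpret pricing_system "M l" G "U l" "S l" "V l" l \<mu>
        by (rule assms(1)[OF elim])
      show ?case
        using elim one_minus_lst_le[of j] lst_le_1[of j] by (simp add: f_def)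
    qed
  qed
  then have "((\<lambda>l. 1 - (1 - f l j)) \<longlongrightarrow> 1 - 0) at_top" for j
    by (intro tendsto_intros)
  then have "((\<lambda>l. f l (Suc j)) \<longlongrightarrow> 1) at_top" for j
    by simp
  then have "((\<lambda>l. l * (1 - 1 / takacs_sum (f l) ?q K)) \<longlongrightarrow> \<mu>' / ?q * real K) at_top"
    using f1 assms(4) by (intro takacs_sum_tendsto) auto
  then have "((\<lambda>l. p * ?q * (l * (1 - 1 / takacs_sum (f l) ?q K))) \<longlongrightarrow>
      p * ?q * (\<mu>' / ?q * real K)) at_top"
    by (intro tendsto_mult_left)
  moreover have "\<forall>\<^sub>F l in at_top. p * ?q * (l * (1 - 1 / takacs_sum (f l) ?q K)) = ?R l"
    using eventually_gt_at_top[of 0] by eventually_elim (simp add: R)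
  \<comment> \<open>The acceptance probability cancels, so the valuation law leaves no trace in the
    limit beyond \<open>0 < ?q\<close>.\<close>
  moreover have "p * ?q * (\<mu>' / ?q * real K) = \<mu>' * p * real K"
    using assms(4) by simp
  ultimately have lim: "(?R \<longlongrightarrow> \<mu>' * p * real K) at_top"
    using Lim_transform_eventually by fastforce
  \<comment> \<open>\<open>Bfun\<close> at \<open>at_top\<close> asks for an eventual bound, which
    any number above the norm of the limit provides.\<close>
  have "Bfun ?R at_top"
    using order_tendstoD(2)[OF tendsto_norm[OF lim], of "norm (\<mu>' * p * real K) + 1"]
    by (intro BfunI[where K = "norm (\<mu>' * p * real K) + 1"]) (auto elim: eventually_mono)
  then show ?thesis
    using rate lim by blast
qed

end
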